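(* Let $(E,\mathcal P)$ be a random locally convex module over $K$ with base $(\Omega,\mathcal F,P)$, $x\in E$ and $M\subset E$ a nonempty $\mathcal T_c$-closed $L^0$-convex set with the countable concatenation property. If $x\notin M$, then there exist $f\in E^*_c$ and $B\in\mathcal F$ with $P(B)>0$ such that: (1) $(\operatorname{Re}f)(x)>\bigvee\{(\operatorname{Re}f)(y):y\in M\}$ on $B$; (2) $(\operatorname{Re}f)(x)=\bigvee\{(\operatorname{Re}f)(y):y\in M\}$ on $B^c$.
   Context: $(\Omega,\mathcal F,P)$ is a probability space and $K=\mathbb R$ or $\mathbb C$. $L^0(\mathcal F,K)$ is the algebra of (a.s.-equality) equivalence classes of $K$-valued $\mathcal F$-measurable random variables; $L^0(\mathcal F)=L^0(\mathcal F,\mathbb R)$; $L^0_+(\mathcal F)$ and $L^0_{++}(\mathcal F)$ are the elements of $L^0(\mathcal F)$ that are $\ge0$, respectively $>0$, a.s. on $\Omega$. $\bar L^0(\mathcal F)$ is the complete lattice of equivalence classes of $[-\infty,\infty]$-valued $\mathcal F$-measurable functions with the a.s. order; $\bigvee$ is the supremum (essential supremum) there. A relation "on $A$" ($A\in\mathcal F$) means it holds for $P$-almost all $\omega\in A$. $\tilde I_A$ is the class of the indicator of $A$. An $L^0$-seminorm on an $L^0(\mathcal F,K)$-module $E$ is a map $\|\cdot\|:E\to L^0_+(\mathcal F)$ with $\|\xi x\|=|\xi|\|x\|$ and $\|x+y\|\le\|x\|+\|y\|$ for $\xi\in L^0(\mathcal F,K)$, $x,y\in E$. A random locally convex module over $K$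 with base $(\Omega,\mathcal F,P)$ is a pair $(E,\mathcal P)$ with $E$ an $L^0(\mathcal F,K)$-module and $\mathcal P$ a family of $L^0$-seminorms on $E$ such that $\bigvee\{\|x\|:\|\cdot\|\in\mathcal P\}=0$ iff $x=\theta$ (the null element). For finite $\mathcal Q\subset\mathcal P$ put $\|x\|_{\mathcal Q}=\bigvee\{\|x\|:\|\cdot\|\in\mathcal Q\}$. The locally $L^0$-convex topology $\mathcal T_c$ on $E$ has local base at $\theta$ consisting of $\{x\in E:\|x\|_{\mathcal Q}\le\varepsilon\}$, $\mathcal Q\subset\mathcal P$ finite, $\varepsilon\in L^0_{++}(\mathcal F)$; $L^0(\mathcal F,K)$ carries the $\mathcal T_c$ induced by $|\cdot|$. $E^*_c$ is the $L^0(\mathcal F,K)$-module of continuous module homomorphisms from $(E,\mathcal T_c)$ to $(L^0(\mathcal F,K),\mathcal T_c)$. $M$ is $L^0$-convex if $\xi x+(1-\xi)y\in M$ for $x,y\in M$, $\xi\in L^0_+(\mathcal F)$, $0\le\xi\le1$. $M$ has the countable concatenation property if for every sequence $\{x_n\}$ in $M$ and every countable partition $\{A_n\}$ of $\Omega$ into sets of $\mathcal F$ there is $x\in M$ with $\tilde I_{A_n}x=\tilde I_{A_n}x_n$ for all $n$. *)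

theory Defs
  imports "HOL-Probability.Probability" "HOL-Algebra.Module" "HOL-Algebra.Complete_Lattice"
begin

section \<open>Equivalence classes of random variables\<close>

text \<open>An element of an \<open>L\<^sup>0\<close>-space over \<open>M\<close> is literally a set of functions, the class of a
  measurable function modulo almost sure equality. The codomain is \<^typ>\<open>complex\<close>, \<^typ>\<open>real\<close> or
  \<^typ>\<open>ereal\<close> below.\<close>

definition rv_class :: "'a measure \<Rightarrow> ('a \<Rightarrow> 'b::topological_space) \<Rightarrow> ('a \<Rightarrow> 'b) set" where
  "rv_class M f = {g \<in> borel_measurable M. AE \<omega> in M. g \<omega> = f \<omega>}"

definition rv_rep :: "('a \<Rightarrow> 'b) set \<Rightarrow> 'a \<Rightarrow> 'b" where
  "rv_rep a = (SOME f. f \<in> a)"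

definition L0 :: "'a measure \<Rightarrow> ('a \<Rightarrow> 'b::topological_space) set set" where
  "L0 M = rv_class M ` borel_measurable M"

definition rv_map ::
    "'a measure \<Rightarrow> ('b \<Rightarrow> 'c::topological_space) \<Rightarrow> ('a \<Rightarrow> 'b) set \<Rightarrow> ('a \<Rightarrow> 'c) set" where
  "rv_map M h a = rv_class M (\<lambda>\<omega>. h (rv_rep a \<omega>))"

definition rv_map2 ::
    "'a measure \<Rightarrow> ('b \<Rightarrow> 'c \<Rightarrow> 'd::topological_space) \<Rightarrow>
      ('a \<Rightarrow> 'b) set \<Rightarrow> ('a \<Rightarrow> 'c) set \<Rightarrow> ('a \<Rightarrow> 'd) set" where
  "rv_map2 M h a b = rv_class M (\<lambda>\<omega>. h (rv_rep a \<omega>) (rv_rep b \<omega>))"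

definition rv_on ::
    "'a measure \<Rightarrow> 'a set \<Rightarrow> ('b \<Rightarrow> 'c \<Rightarrow> bool) \<Rightarrow> ('a \<Rightarrow> 'b) set \<Rightarrow> ('a \<Rightarrow> 'c) set \<Rightarrow> bool" where
  "rv_on M A R a b \<longleftrightarrow> (AE \<omega> in M. \<omega> \<in> A \<longrightarrow> R (rv_rep a \<omega>) (rv_rep b \<omega>))"

definition L0_plus :: "'a measure \<Rightarrow> ('a \<Rightarrow> real) set set" where
  "L0_plus M = {a \<in> L0 M. rv_on M (space M) (\<le>) (rv_class M (\<lambda>_. 0)) a}"

definition L0_pplus :: "'a measure \<Rightarrow> ('a \<Rightarrow> real) set set" where
  "L0_pplus M = {a \<in> L0 M. rv_on M (space M) (<) (rv_class M (\<lambda>_. 0)) a}"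

text \<open>The lattice of extended real valued classes. Suprema of families of (real) classes are always
  taken in it, after applying the embedding \<open>rv_map M ereal\<close>; thus
  \<open>\<Squnion>\<^bsub>L0_bar M\<^esub>{}\<close> is the class of \<open>-\<infinity>\<close>.\<close>

definition L0_bar :: "'a measure \<Rightarrow> ('a \<Rightarrow> ereal) set gorder" where
  "L0_bar M = \<lparr>carrier = L0 M, eq = (=), le = rv_on M (space M) (\<le>)\<rparr>"

text \<open>The algebra \<open>L\<^sup>0(F, K)\<close> for \<open>K = \<real>\<close> or \<open>K = UNIV\<close>, as subsets of \<^typ>\<open>complex\<close>. For
  \<open>K = \<real>\<close> its elements are the classes of complex random variables that are almost surely real.\<close>

definition L0_ring :: "'a measure \<Rightarrow> complex set \<Rightarrow> ('a \<Rightarrow> complex) set ring" where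
  "L0_ring M K =
    \<lparr>carrier = rv_class M ` {f \<in> borel_measurable M. \<forall>\<omega>\<in>space M. f \<omega> \<in> K},
     mult = rv_map2 M (*),
     one = rv_class M (\<lambda>_. 1),
     zero = rv_class M (\<lambda>_. 0),
     add = rv_map2 M (+)\<rparr>"

definition L0_indicator :: "'a measure \<Rightarrow> 'a set \<Rightarrow> ('a \<Rightarrow> complex) set" where
  "L0_indicator M A = rv_class M (indicator A)"


subsection \<open>Computing with representatives\<close>

lemma rv_class_cong:
  assumes "AE \<omega> in M. f \<omega> = g \<omega>"
  shows "rv_class M f = rv_class M g"
proof -
  have "(AE \<omega> in M. h \<omega> = f \<omega>) \<longleftrightarrow> (AE \<omega> in M. h \<omega> = g \<omega>)" for h
  proof
    assume "AE \<omega> in M. h \<omega> = f \<omega>"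
    with assms show "AE \<omega> in M. h \<omega> = g \<omega>" by eventually_elim simp
  next
    assume "AE \<omega> in M. h \<omega> = g \<omega>"
    with assms show "AE \<omega> in M. h \<omega> = f \<omega>" by eventually_elim simp
  qed
  then show ?thesis by (simp add: rv_class_def)
qed

lemma rv_rep_class:
  assumes "f \<in> borel_measurable M"
  shows "rv_rep (rv_class M f) \<in> borel_measurable M"
    and "AE \<omega> in M. rv_rep (rv_class M f) \<omega> = f \<omega>"
proof -
  have "f \<in> rv_class M f" using assms by (simp add: rv_class_def)
  then have "rv_rep (rv_class M f) \<in> rv_class M f" unfolding rv_rep_def
    by (rule someI[where P = "\<lambda>g. g \<in> rv_class M f"])
  then show "rv_rep (rv_class M f) \<in> borel_measurable M"
    and "AE \<omega> in M. rv_rep (rv_class M f) \<omega> = f \<omega>"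
    by (simp_all add: rv_class_def)
qed

lemma rv_class_L0 [simp]: "f \<in> borel_measurable M \<Longrightarrow> rv_class M f \<in> L0 M"
  by (simp add: L0_def)

lemma L0_rep:
  assumes "a \<in> L0 M"
  shows "rv_rep a \<in> borel_measurable M" and "rv_class M (rv_rep a) = a"
proof -
  obtain f where f: "f \<in> borel_measurable M" and a: "a = rv_class M f"
    using assms by (auto simp: L0_def)
  show "rv_rep a \<in> borel_measurable M" using rv_rep_class(1)[OF f] a by simp
  show "rv_class M (rv_rep a) = a" using rv_class_cong[OF rv_rep_class(2)[OF f]] a by simp
qed

lemma rv_map_class:
  assumes "f \<in> borel_measurable M"
  shows "rv_map M h (rv_class M f) = rv_class M (\<lambda>\<omega>. h (f \<omega>))"
  unfolding rv_map_def by (rule rv_class_cong) (use rv_rep_class(2)[OF assms] in auto)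

lemma rv_map2_class:
  assumes "f \<in> borel_measurable M" and "g \<in> borel_measurable M"
  shows "rv_map2 M h (rv_class M f) (rv_class M g) = rv_class M (\<lambda>\<omega>. h (f \<omega>) (g \<omega>))"
  unfolding rv_map2_def
  by (rule rv_class_cong) (use rv_rep_class(2)[OF assms(1)] rv_rep_class(2)[OF assms(2)] in auto)

lemma rv_on_class:
  assumes "f \<in> borel_measurable M" and "g \<in> borel_measurable M"
  shows "rv_on M A R (rv_class M f) (rv_class M g) \<longleftrightarrow> (AE \<omega> in M. \<omega> \<in> A \<longrightarrow> R (f \<omega>) (g \<omega>))"
proof -
  have e: "AE \<omega> in M. rv_rep (rv_class M f) \<omega> = f \<omega> \<and> rv_rep (rv_class M g) \<omega> = g \<omega>"
    using rv_rep_class(2)[OF assms(1)] rv_rep_class(2)[OF assms(2)] by auto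
  show ?thesis unfolding rv_on_def
  proof
    assume "AE \<omega> in M. \<omega> \<in> A \<longrightarrow> R (rv_rep (rv_class M f) \<omega>) (rv_rep (rv_class M g) \<omega>)"
    with e show "AE \<omega> in M. \<omega> \<in> A \<longrightarrow> R (f \<omega>) (g \<omega>)" by eventually_elim auto
  next
    assume "AE \<omega> in M. \<omega> \<in> A \<longrightarrow> R (f \<omega>) (g \<omega>)"
    with e show "AE \<omega> in M. \<omega> \<in> A \<longrightarrow> R (rv_rep (rv_class M f) \<omega>) (rv_rep (rv_class M g) \<omega>)"
      by eventually_elim auto
  qed
qed

lemma rv_class_eq_iff:
  assumes "f \<in> borel_measurable M" and "g \<in> borel_measurable M"
  shows "rv_class M f = rv_class M g \<longleftrightarrow> (AE \<omega> in M. f \<omega> = g \<omega>)"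
proof
  assume "rv_class M f = rv_class M g"
  then have "f \<in> rv_class M g" using assms by (auto simp: rv_class_def)
  then show "AE \<omega> in M. f \<omega> = g \<omega>" by (simp add: rv_class_def)
qed (rule rv_class_cong)

lemma L0_bar_simps [simp]: "carrier (L0_bar M) = L0 M" "(.=\<^bsub>L0_bar M\<^esub>) = (=)"
  by (simp_all add: L0_bar_def)

lemma L0_bar_le_iff:
  assumes "a \<in> L0 M" and "b \<in> L0 M"
  shows "a \<sqsubseteq>\<^bsub>L0_bar M\<^esub> b \<longleftrightarrow> (AE \<omega> in M. rv_rep a \<omega> \<le> rv_rep b \<omega>)"
proof -
  have "(AE \<omega> in M. \<omega> \<in> space M \<longrightarrow> rv_rep a \<omega> \<le> rv_rep b \<omega>) \<longleftrightarrow>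
      (AE \<omega> in M. rv_rep a \<omega> \<le> rv_rep b \<omega>)"
    by (rule AE_cong) simp
  then show ?thesis by (simp add: L0_bar_def rv_on_def)
qed

lemma partial_order_L0_bar: "partial_order (L0_bar M)"
proof
  fix a b c :: "('a \<Rightarrow> ereal) set"
  assume "a \<in> carrier (L0_bar M)" "b \<in> carrier (L0_bar M)"
  then have ab: "a \<in> L0 M" "b \<in> L0 M" by simp_all
  then show "a \<sqsubseteq>\<^bsub>L0_bar M\<^esub> a" by (simp add: L0_bar_le_iff)
  show "a .=\<^bsub>L0_bar M\<^esub> b" if "a \<sqsubseteq>\<^bsub>L0_bar M\<^esub> b" "b \<sqsubseteq>\<^bsub>L0_bar M\<^esub> a"
  proof -
    have "AE \<omega> in M. rv_rep a \<omega> \<le> rv_rep b \<omega>" "AE \<omega> in M. rv_rep b \<omega> \<le> rv_rep a \<omega>"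
      using that ab by (simp_all add: L0_bar_le_iff)
    then have "AE \<omega> in M. rv_rep a \<omega> = rv_rep b \<omega>" by eventually_elim auto
    from rv_class_cong[OF this] show ?thesis by (simp add: L0_rep(2) ab)
  qed
  assume "c \<in> carrier (L0_bar M)"
  then have c: "c \<in> L0 M" by simp
  show "a \<sqsubseteq>\<^bsub>L0_bar M\<^esub> c" if "a \<sqsubseteq>\<^bsub>L0_bar M\<^esub> b" "b \<sqsubseteq>\<^bsub>L0_bar M\<^esub> c"
  proof -
    have "AE \<omega> in M. rv_rep a \<omega> \<le> rv_rep b \<omega>" "AE \<omega> in M. rv_rep b \<omega> \<le> rv_rep c \<omega>"
      using that ab c by (simp_all add: L0_bar_le_iff)
    then have "AE \<omega> in M. rv_rep a \<omega> \<le> rv_rep c \<omega>" by eventually_elim auto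
    then show ?thesis using ab c by (simp add: L0_bar_le_iff)
  qed
qed (auto simp: L0_bar_def)

lemma L0_bar_Sup_countable:
  assumes "countable I" and "\<And>i. i \<in> I \<Longrightarrow> a i \<in> L0 M"
  shows "\<Squnion>\<^bsub>L0_bar M\<^esub>(a ` I) = rv_class M (\<lambda>\<omega>. SUP i\<in>I. rv_rep (a i) \<omega>)"
proof -
  interpret partial_order "L0_bar M" by (rule partial_order_L0_bar)
  let ?s = "\<lambda>\<omega>. SUP i\<in>I. rv_rep (a i) \<omega>"
  have s: "?s \<in> borel_measurable M"
    using assms by (intro borel_measurable_SUP) (auto simp: L0_rep)
  have sc: "AE \<omega> in M. rv_rep (rv_class M ?s) \<omega> = ?s \<omega>" by (rule rv_rep_class(2)[OF s])
  have lub: "least (L0_bar M) (rv_class M ?s) (Upper (L0_bar M) (a ` I))"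
  proof (rule least_UpperI)
    fix x assume "x \<in> a ` I"
    then obtain i where i: "i \<in> I" "x = a i" by auto
    have "AE \<omega> in M. rv_rep (a i) \<omega> \<le> rv_rep (rv_class M ?s) \<omega>"
      using sc by eventually_elim (use i in \<open>auto intro: SUP_upper\<close>)
    then show "x \<sqsubseteq>\<^bsub>L0_bar M\<^esub> rv_class M ?s"
      using i assms s by (simp add: L0_bar_le_iff)
  next
    fix y assume "y \<in> Upper (L0_bar M) (a ` I)"
    then have y: "y \<in> L0 M" and "\<forall>i\<in>I. a i \<sqsubseteq>\<^bsub>L0_bar M\<^esub> y"
      using assms(2) by (auto simp: Upper_def)
    then have "AE \<omega> in M. \<forall>i\<in>I. rv_rep (a i) \<omega> \<le> rv_rep y \<omega>"
      using assms by (subst AE_ball_countable) (auto simp: L0_bar_le_iff)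
    with sc have "AE \<omega> in M. rv_rep (rv_class M ?s) \<omega> \<le> rv_rep y \<omega>"
      by eventually_elim (auto intro: SUP_least)
    then show "rv_class M ?s \<sqsubseteq>\<^bsub>L0_bar M\<^esub> y" using y s by (simp add: L0_bar_le_iff)
  qed (use assms s in auto)
  show ?thesis unfolding Lattice.sup_def
    by (rule some_equality, rule lub, rule least_unique[OF _ lub])
qed

lemma cring_L0_ring:
  assumes "K = \<real> \<or> K = UNIV"
  shows "cring (L0_ring M K)"
proof -
  have K: "0 \<in> K" "1 \<in> K" "x \<in> K \<Longrightarrow> y \<in> K \<Longrightarrow> x + y \<in> K" "x \<in> K \<Longrightarrow> y \<in> K \<Longrightarrow> x * y \<in> K"
    "x \<in> K \<Longrightarrow> - x \<in> K" for x y
    using assms by auto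
  define F where "F = {f \<in> borel_measurable M. \<forall>\<omega>\<in>space M. f \<omega> \<in> K}"
  have F: "f \<in> borel_measurable M" if "f \<in> F" for f using that by (simp add: F_def)
  have c: "carrier (L0_ring M K) = rv_class M ` F" by (simp add: L0_ring_def F_def)
  have z: "\<zero>\<^bsub>L0_ring M K\<^esub> = rv_class M (\<lambda>_. 0)" and o: "\<one>\<^bsub>L0_ring M K\<^esub> = rv_class M (\<lambda>_. 1)"
    by (simp_all add: L0_ring_def)
  have a: "rv_class M f \<oplus>\<^bsub>L0_ring M K\<^esub> rv_class M g = rv_class M (\<lambda>\<omega>. f \<omega> + g \<omega>)"
    and m: "rv_class M f \<otimes>\<^bsub>L0_ring M K\<^esub> rv_class M g = rv_class M (\<lambda>\<omega>. f \<omega> * g \<omega>)"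
    if "f \<in> F" "g \<in> F" for f g
    using that[THEN F] by (simp_all add: L0_ring_def rv_map2_class)
  have cl: "(\<lambda>\<omega>. f \<omega> + g \<omega>) \<in> F" "(\<lambda>\<omega>. f \<omega> * g \<omega>) \<in> F" if "f \<in> F" "g \<in> F" for f g
    using that K by (auto simp: F_def)
  have ng: "(\<lambda>\<omega>. - f \<omega>) \<in> F" if "f \<in> F" for f
    using that K by (auto simp: F_def)
  have cst: "(\<lambda>_. 0) \<in> F" "(\<lambda>_. 1) \<in> F" using K by (auto simp: F_def)
  have inv: "\<exists>g\<in>F. rv_class M (\<lambda>\<omega>. f \<omega> + g \<omega>) = rv_class M (\<lambda>_. 0)" if "f \<in> F" for f
    by (rule bexI[of _ "\<lambda>\<omega>. - f \<omega>"]) (simp_all add: ng that)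
  show ?thesis
    by (intro cringI abelian_groupI comm_monoidI; unfold c z o)
      (auto simp: a m cl cst inv algebra_simps)
qed


section \<open>Random locally convex modules\<close>

definition L0_seminorm ::
    "'a measure \<Rightarrow> complex set \<Rightarrow> (('a \<Rightarrow> complex) set, 'e, 'm) module_scheme \<Rightarrow>
      ('e \<Rightarrow> ('a \<Rightarrow> real) set) \<Rightarrow> bool" where
  "L0_seminorm M K E p \<longleftrightarrow>
    p \<in> carrier E \<rightarrow> L0_plus M \<and>
    (\<forall>\<xi>\<in>carrier (L0_ring M K). \<forall>x\<in>carrier E.
      p (\<xi> \<odot>\<^bsub>E\<^esub> x) = rv_map2 M (*) (rv_map M cmod \<xi>) (p x)) \<and>
    (\<forall>x\<in>carrier E. \<forall>y\<in>carrier E.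
      rv_on M (space M) (\<le>) (p (x \<oplus>\<^bsub>E\<^esub> y)) (rv_map2 M (+) (p x) (p y)))"

definition Sup_seminorm ::
    "'a measure \<Rightarrow> ('e \<Rightarrow> ('a \<Rightarrow> real) set) set \<Rightarrow> 'e \<Rightarrow> ('a \<Rightarrow> ereal) set" where
  "Sup_seminorm M Q x = \<Squnion>\<^bsub>L0_bar M\<^esub>((\<lambda>p. rv_map M ereal (p x)) ` Q)"

locale random_locally_convex_module =
  prob_space M + Module.module "L0_ring M K" E
  for M :: "'a measure" and K :: "complex set"
    and E :: "(('a \<Rightarrow> complex) set, 'e, 'm) module_scheme"
    and P :: "('e \<Rightarrow> ('a \<Rightarrow> real) set) set" +
  assumes K_cases: "K = \<real> \<or> K = UNIV"
    and seminorm: "p \<in> P \<Longrightarrow> L0_seminorm M K E p"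
    and separating:
      "x \<in> carrier E \<Longrightarrow> Sup_seminorm M P x = rv_class M (\<lambda>_. 0) \<longleftrightarrow> x = \<zero>\<^bsub>E\<^esub>"

definition L0_nbhd ::
    "'a measure \<Rightarrow> ('e, 'm) ring_scheme \<Rightarrow> ('e \<Rightarrow> ('a \<Rightarrow> real) set) set \<Rightarrow>
      ('a \<Rightarrow> real) set \<Rightarrow> 'e set" where
  "L0_nbhd M E Q \<epsilon> = {x \<in> carrier E. Sup_seminorm M Q x \<sqsubseteq>\<^bsub>L0_bar M\<^esub> rv_map M ereal \<epsilon>}"

text \<open>The translation invariant topology with local base \<open>L0_nbhd M E Q \<epsilon>\<close> at the null element;
  \<open>openin_Tc\<close> below justifies the use of \<^const>\<open>topology\<close>. Only the additive
  structure of \<open>E\<close> enters, so the definition applies both to modules and to \<^const>\<open>L0_ring\<close>.\<close>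

definition L0_open ::
    "'a measure \<Rightarrow> ('e, 'm) ring_scheme \<Rightarrow> ('e \<Rightarrow> ('a \<Rightarrow> real) set) set \<Rightarrow> 'e set \<Rightarrow> bool" where
  "L0_open M E P U \<longleftrightarrow> U \<subseteq> carrier E \<and>
    (\<forall>x\<in>U. \<exists>Q \<epsilon>. finite Q \<and> Q \<subseteq> P \<and> \<epsilon> \<in> L0_pplus M \<and>
      (\<lambda>y. x \<oplus>\<^bsub>E\<^esub> y) ` L0_nbhd M E Q \<epsilon> \<subseteq> U)"

definition Tc ::
    "'a measure \<Rightarrow> ('e, 'm) ring_scheme \<Rightarrow> ('e \<Rightarrow> ('a \<Rightarrow> real) set) set \<Rightarrow> 'e topology" where
  "Tc M E P = topology (L0_open M E P)"

subsection \<open>The topology is well defined\<close>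

lemma Sup_seminorm_finite:
  assumes "finite Q" and "\<And>p. p \<in> Q \<Longrightarrow> p x \<in> L0 M"
  shows "Sup_seminorm M Q x = rv_class M (\<lambda>\<omega>. SUP p\<in>Q. ereal (rv_rep (p x) \<omega>))"
    and "Sup_seminorm M Q x \<in> L0 M"
    and "\<epsilon> \<in> L0 M \<Longrightarrow> Sup_seminorm M Q x \<sqsubseteq>\<^bsub>L0_bar M\<^esub> rv_map M ereal \<epsilon> \<longleftrightarrow>
      (AE \<omega> in M. \<forall>p\<in>Q. rv_rep (p x) \<omega> \<le> rv_rep \<epsilon> \<omega>)"
proof -
  let ?s = "\<lambda>\<omega>. SUP p\<in>Q. ereal (rv_rep (p x) \<omega>)"
  have m: "(\<lambda>\<omega>. ereal (rv_rep (p x) \<omega>)) \<in> borel_measurable M" if "p \<in> Q" for p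
    using L0_rep(1)[OF assms(2)[OF that]] by measurable
  have s: "?s \<in> borel_measurable M"
    using assms m by (intro borel_measurable_SUP countable_finite) auto
  have "Sup_seminorm M Q x = rv_class M (\<lambda>\<omega>. SUP p\<in>Q. rv_rep (rv_map M ereal (p x)) \<omega>)"
    unfolding Sup_seminorm_def using assms m
    by (intro L0_bar_Sup_countable countable_finite) (auto simp: rv_map_def)
  also have "\<dots> = rv_class M ?s"
  proof (rule rv_class_cong)
    have "AE \<omega> in M. \<forall>p\<in>Q. rv_rep (rv_map M ereal (p x)) \<omega> = ereal (rv_rep (p x) \<omega>)"
      using assms m rv_rep_class(2)
      by (subst AE_ball_countable) (auto simp: rv_map_def countable_finite)
    then show "AE \<omega> in M. (SUP p\<in>Q. rv_rep (rv_map M ereal (p x)) \<omega>) = ?s \<omega>"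
      by eventually_elim (auto intro: SUP_cong)
  qed
  finally show eq: "Sup_seminorm M Q x = rv_class M ?s" .
  then show "Sup_seminorm M Q x \<in> L0 M" using s by simp
  assume e: "\<epsilon> \<in> L0 M"
  have em: "(\<lambda>\<omega>. ereal (rv_rep \<epsilon> \<omega>)) \<in> borel_measurable M"
    using L0_rep(1)[OF e] by measurable
  have "Sup_seminorm M Q x \<sqsubseteq>\<^bsub>L0_bar M\<^esub> rv_map M ereal \<epsilon> \<longleftrightarrow>
      (AE \<omega> in M. \<omega> \<in> space M \<longrightarrow> ?s \<omega> \<le> ereal (rv_rep \<epsilon> \<omega>))"
    unfolding eq rv_map_def L0_bar_def by (simp add: rv_on_class[OF s em])
  also have "\<dots> \<longleftrightarrow> (AE \<omega> in M. \<forall>p\<in>Q. rv_rep (p x) \<omega> \<le> rv_rep \<epsilon> \<omega>)"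
    by (rule AE_cong) (auto simp: SUP_le_iff)
  finally show "Sup_seminorm M Q x \<sqsubseteq>\<^bsub>L0_bar M\<^esub> rv_map M ereal \<epsilon> \<longleftrightarrow>
      (AE \<omega> in M. \<forall>p\<in>Q. rv_rep (p x) \<omega> \<le> rv_rep \<epsilon> \<omega>)" .
qed

lemma L0_pplus_iff:
  "\<epsilon> \<in> L0_pplus M \<longleftrightarrow> \<epsilon> \<in> L0 M \<and> (AE \<omega> in M. 0 < rv_rep \<epsilon> \<omega>)"
proof -
  have "rv_on M (space M) (<) (rv_class M (\<lambda>_. 0)) \<epsilon> \<longleftrightarrow> (AE \<omega> in M. 0 < rv_rep \<epsilon> \<omega>)"
    if e: "\<epsilon> \<in> L0 M"
  proof -
    have "rv_on M (space M) (<) (rv_class M (\<lambda>_. 0)) (rv_class M (rv_rep \<epsilon>)) \<longleftrightarrow>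
        (AE \<omega> in M. \<omega> \<in> space M \<longrightarrow> 0 < rv_rep \<epsilon> \<omega>)"
      by (rule rv_on_class) (use L0_rep[OF e] in auto)
    also have "\<dots> \<longleftrightarrow> (AE \<omega> in M. 0 < rv_rep \<epsilon> \<omega>)" by (rule AE_cong) simp
    finally show ?thesis using L0_rep[OF e] by simp
  qed
  then show ?thesis by (auto simp: L0_pplus_def)
qed

lemma istopology_L0_open:
  assumes P: "\<And>p. p \<in> P \<Longrightarrow> p \<in> carrier E \<rightarrow> L0_plus M"
  shows "istopology (L0_open M E P)"
  unfolding istopology_def
proof (intro conjI allI impI)
  fix U V assume U: "L0_open M E P U" and V: "L0_open M E P V"
  show "L0_open M E P (U \<inter> V)"
    unfolding L0_open_def
  proof (intro conjI ballI)
    show "U \<inter> V \<subseteq> carrier E" using U by (auto simp: L0_open_def)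
    fix x assume "x \<in> U \<inter> V"
    then have "x \<in> U" "x \<in> V" by auto
    obtain Q1 e1 where
      1: "finite Q1" "Q1 \<subseteq> P" "e1 \<in> L0_pplus M" "(\<lambda>y. x \<oplus>\<^bsub>E\<^esub> y) ` L0_nbhd M E Q1 e1 \<subseteq> U"
      using U \<open>x \<in> U\<close> unfolding L0_open_def by fast
    obtain Q2 e2 where
      2: "finite Q2" "Q2 \<subseteq> P" "e2 \<in> L0_pplus M" "(\<lambda>y. x \<oplus>\<^bsub>E\<^esub> y) ` L0_nbhd M E Q2 e2 \<subseteq> V"
      using V \<open>x \<in> V\<close> unfolding L0_open_def by fast
    let ?g = "\<lambda>\<omega>. min (rv_rep e1 \<omega>) (rv_rep e2 \<omega>)"
    have e: "e1 \<in> L0 M" "e2 \<in> L0 M" using 1 2 by (auto simp: L0_pplus_iff)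
    have g: "?g \<in> borel_measurable M" using e[THEN L0_rep(1)] by measurable
    define e3 where "e3 = rv_class M ?g"
    have e3: "e3 \<in> L0 M" and r3: "AE \<omega> in M. rv_rep e3 \<omega> = ?g \<omega>"
      using g rv_rep_class(2)[OF g] by (auto simp: e3_def)
    have "AE \<omega> in M. 0 < rv_rep e1 \<omega>" "AE \<omega> in M. 0 < rv_rep e2 \<omega>"
      using 1 2 by (auto simp: L0_pplus_iff)
    with r3 have "AE \<omega> in M. 0 < rv_rep e3 \<omega>" by eventually_elim auto
    then have p3: "e3 \<in> L0_pplus M" using e3 by (simp add: L0_pplus_iff)
    have L: "p y \<in> L0 M" if "p \<in> Q1 \<union> Q2" "y \<in> carrier E" for p y
    proof -
      have "p \<in> P" using that 1 2 by auto
      from funcset_mem[OF P[OF this] that(2)] show ?thesis by (simp add: L0_plus_def)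
    qed
    have sub: "L0_nbhd M E (Q1 \<union> Q2) e3 \<subseteq> L0_nbhd M E Q1 e1 \<inter> L0_nbhd M E Q2 e2"
    proof
      fix y assume "y \<in> L0_nbhd M E (Q1 \<union> Q2) e3"
      then have y: "y \<in> carrier E"
        and "Sup_seminorm M (Q1 \<union> Q2) y \<sqsubseteq>\<^bsub>L0_bar M\<^esub> rv_map M ereal e3"
        by (auto simp: L0_nbhd_def)
      then have "AE \<omega> in M. \<forall>p\<in>Q1 \<union> Q2. rv_rep (p y) \<omega> \<le> rv_rep e3 \<omega>"
        using Sup_seminorm_finite(3)[of "Q1 \<union> Q2" y M e3] L 1 2 e3 by auto
      with r3 have "AE \<omega> in M. (\<forall>p\<in>Q1. rv_rep (p y) \<omega> \<le> rv_rep e1 \<omega>) \<and>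
          (\<forall>p\<in>Q2. rv_rep (p y) \<omega> \<le> rv_rep e2 \<omega>)"
        by eventually_elim auto
      then show "y \<in> L0_nbhd M E Q1 e1 \<inter> L0_nbhd M E Q2 e2"
        using Sup_seminorm_finite(3)[of Q1 y M e1] Sup_seminorm_finite(3)[of Q2 y M e2] L 1 2 e y
        by (auto simp: L0_nbhd_def)
    qed
    show "\<exists>Q \<epsilon>. finite Q \<and> Q \<subseteq> P \<and> \<epsilon> \<in> L0_pplus M \<and>
        (\<lambda>y. x \<oplus>\<^bsub>E\<^esub> y) ` L0_nbhd M E Q \<epsilon> \<subseteq> U \<inter> V"
    proof (intro exI conjI)
      show "(\<lambda>y. x \<oplus>\<^bsub>E\<^esub> y) ` L0_nbhd M E (Q1 \<union> Q2) e3 \<subseteq> U \<inter> V"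
        using image_mono[OF sub, of "\<lambda>y. x \<oplus>\<^bsub>E\<^esub> y"] 1(4) 2(4) by auto
    qed (use 1 2 p3 in auto)
  qed
next
  fix \<U> assume o: "\<forall>U\<in>\<U>. L0_open M E P U"
  show "L0_open M E P (\<Union>\<U>)"
    unfolding L0_open_def
  proof (intro conjI ballI)
    show "\<Union>\<U> \<subseteq> carrier E" using o by (auto simp: L0_open_def)
    fix x assume "x \<in> \<Union>\<U>"
    then obtain U where U: "U \<in> \<U>" "x \<in> U" by blast
    then have "L0_open M E P U" using o by blast
    then obtain Q \<epsilon> where "finite Q" "Q \<subseteq> P" "\<epsilon> \<in> L0_pplus M"
      "(\<lambda>y. x \<oplus>\<^bsub>E\<^esub> y) ` L0_nbhd M E Q \<epsilon> \<subseteq> U"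
      using U unfolding L0_open_def by fast
    moreover have "U \<subseteq> \<Union>\<U>" using U by blast
    ultimately show "\<exists>Q \<epsilon>. finite Q \<and> Q \<subseteq> P \<and> \<epsilon> \<in> L0_pplus M \<and>
        (\<lambda>y. x \<oplus>\<^bsub>E\<^esub> y) ` L0_nbhd M E Q \<epsilon> \<subseteq> \<Union>\<U>"
      by (meson subset_trans)
  qed
qed

lemma openin_Tc:
  assumes "\<And>p. p \<in> P \<Longrightarrow> p \<in> carrier E \<rightarrow> L0_plus M"
  shows "openin (Tc M E P) = L0_open M E P"
  unfolding Tc_def by (rule topology_inverse'[OF istopology_L0_open[OF assms]])


subsection \<open>Dual and convexity notions\<close>

definition Ec_dual ::
    "'a measure \<Rightarrow> complex set \<Rightarrow> (('a \<Rightarrow> complex) set, 'e, 'm) module_scheme \<Rightarrow>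
      ('e \<Rightarrow> ('a \<Rightarrow> real) set) set \<Rightarrow> ('e \<Rightarrow> ('a \<Rightarrow> complex) set) set" where
  "Ec_dual M K E P = {f \<in> carrier E \<rightarrow> carrier (L0_ring M K).
    (\<forall>x\<in>carrier E. \<forall>y\<in>carrier E. f (x \<oplus>\<^bsub>E\<^esub> y) = f x \<oplus>\<^bsub>L0_ring M K\<^esub> f y) \<and>
    (\<forall>\<xi>\<in>carrier (L0_ring M K). \<forall>x\<in>carrier E. f (\<xi> \<odot>\<^bsub>E\<^esub> x) = \<xi> \<otimes>\<^bsub>L0_ring M K\<^esub> f x) \<and>
    continuous_map (Tc M E P) (Tc M (L0_ring M K) {rv_map M cmod}) f}"

definition L0_convex ::
    "'a measure \<Rightarrow> complex set \<Rightarrow> (('a \<Rightarrow> complex) set, 'e, 'm) module_scheme \<Rightarrow>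
      'e set \<Rightarrow> bool" where
  "L0_convex M K E C \<longleftrightarrow>
    (\<forall>x\<in>C. \<forall>y\<in>C. \<forall>\<xi>\<in>L0_plus M. rv_on M (space M) (\<le>) \<xi> (rv_class M (\<lambda>_. 1)) \<longrightarrow>
      (rv_map M complex_of_real \<xi> \<odot>\<^bsub>E\<^esub> x) \<oplus>\<^bsub>E\<^esub>
      ((\<one>\<^bsub>L0_ring M K\<^esub> \<ominus>\<^bsub>L0_ring M K\<^esub> rv_map M complex_of_real \<xi>) \<odot>\<^bsub>E\<^esub> y) \<in> C)"

text \<open>Countable partitions are indexed by \<^typ>\<open>nat\<close>, with empty members allowed, so that finite
  partitions are included.\<close>

definition countable_concatenation ::
    "'a measure \<Rightarrow> (('a \<Rightarrow> complex) set, 'e, 'm) module_scheme \<Rightarrow> 'e set \<Rightarrow> bool" where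
  "countable_concatenation M E C \<longleftrightarrow>
    (\<forall>(x :: nat \<Rightarrow> 'e) A. range x \<subseteq> C \<and> range A \<subseteq> sets M \<and> disjoint_family A \<and>
        (\<Union>n. A n) = space M \<longrightarrow>
      (\<exists>z\<in>C. \<forall>n. L0_indicator M (A n) \<odot>\<^bsub>E\<^esub> z = L0_indicator M (A n) \<odot>\<^bsub>E\<^esub> x n))"

end

(* The closed set C misses a neighbourhood x + {y. |y|_Q <= eps}, and |.|_Q is at most the sum q of the
   seminorms in Q. Pasting elements of C by countable concatenation, an exhaustion argument gives a
   set B of positive probability with q (y - x) >= eps on B for all y in C. The essential infimum of
   q (z + t (y - x)) - t eps I_B over y in C and real t >= 0 is then finite and sublinear in z, and a
   minimal sublinear L0-valued function below it is additive. An additive f with |f| <= q is local,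
   hence L0-linear and continuous, and f (y - x) >= eps on B. The functional sought is the complex
   extension of -f, multiplied by the indicator of B. *)

theory Submission
  imports Defs
begin

text \<open>That x lies outside C only says that each single y in C violates the bound with positive
  probability, on an event that may depend on y. Concatenation turns these events into one common
  \<open>B\<close>; off \<open>B\<close> no positive lower bound is available, so the constraint
  carries the indicator. Extending a functional vector by vector is awkward here: L0 has zero
  divisors, so the submodule generated by a vector need not be free and a value prescribed on its
  generator may be inconsistent. Minimal sublinear functions avoid submodules altogether and need
  only order completeness of the values, which essential infima supply. Finiteness comes from q (z +
  t (y - x)) >= q (t (y - x)) - q (- z) >= t eps I_B - q (- z); subadditivity comes from convexity,
  which makes the pairs (t (y - x), t) a cone. Locality follows from |f (g z)| <= |g| q z, which
  vanishes wherever g does. The sign is reversed at the end because f is larger on C than at x, and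
  the indicator makes both sides of (2) zero off \<open>B\<close>.\<close>

section \<open>Essential suprema of families\<close>

text \<open>Measures of countable unions of members are bounded, and their supremum is attained by
  merging a maximizing sequence of unions. Joining one more \<open>A i\<close> to a maximal union
  cannot raise its measure, so only a null set is added.\<close>

lemma (in finite_measure) essential_union:
  assumes A: "\<And>i. i \<in> I \<Longrightarrow> A i \<in> sets M" and "I \<noteq> {}"
  obtains s :: "nat \<Rightarrow> 'i" where "range s \<subseteq> I"
    and "\<And>i. i \<in> I \<Longrightarrow> AE \<omega> in M. \<omega> \<in> A i \<longrightarrow> \<omega> \<in> (\<Union>n. A (s n))"
proof -
  define S where "S = {s :: nat \<Rightarrow> 'i. range s \<subseteq> I}"
  define m where "m s = measure M (\<Union>n. A (s n))" for s :: "nat \<Rightarrow> 'i"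
  have meas: "(\<Union>n. A (s n)) \<in> sets M" if "s \<in> S" for s
    using that A by (auto simp: S_def)
  obtain i0 where "i0 \<in> I" using \<open>I \<noteq> {}\<close> by blast
  then have S: "(\<lambda>_. i0) \<in> S" by (auto simp: S_def)
  have bdd: "bdd_above (m ` S)"
    unfolding m_def by (rule bdd_aboveI[of _ "measure M (space M)"]) (auto intro: bounded_measure)
  define c where "c = (SUP s\<in>S. m s)"
  have le_c: "m s \<le> c" if "s \<in> S" for s
    unfolding c_def by (rule cSUP_upper[OF that bdd])
  have "\<exists>s\<in>S. c - 1 / real (Suc k) < m s" for k
    using less_cSUP_iff[of S m "c - 1 / real (Suc k)"] S bdd by (auto simp: c_def)
  then obtain t where t: "\<And>k. t k \<in> S" "\<And>k. c - 1 / real (Suc k) < m (t k)"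
    by metis
  \<comment> \<open>Pairing interleaves the sequences \<open>t k\<close> into one sequence, whose
    union contains the union belonging to each \<open>t k\<close>.\<close>
  define s where "s n = t (fst (prod_decode n)) (snd (prod_decode n))" for n
  have s: "s \<in> S" using t(1) by (auto simp: S_def s_def)
  have t_le: "(\<Union>n. A (t k n)) \<subseteq> (\<Union>n. A (s n))" for k
  proof (rule UN_least)
    fix n
    have "A (t k n) = A (s (prod_encode (k, n)))" by (simp add: s_def)
    then show "A (t k n) \<subseteq> (\<Union>n. A (s n))" by blast
  qed
  have "c - 1 / real (Suc k) < m s" for k
    using t(2)[of k] finite_measure_mono[OF t_le meas[OF s], of k] by (simp add: m_def)
  then have "c - 1 / real (Suc k) \<le> m s" for k by (simp add: less_imp_le)
  moreover have "(\<lambda>k. c - 1 / real (Suc k)) \<longlonglongrightarrow> c - 0"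
    by (intro tendsto_intros LIMSEQ_Suc lim_1_over_n)
  ultimately have c: "c \<le> m s" using LIMSEQ_le_const2[of _ "c - 0" "m s"] by auto
  have "AE \<omega> in M. \<omega> \<in> A i \<longrightarrow> \<omega> \<in> (\<Union>n. A (s n))" if i: "i \<in> I" for i
  proof -
    \<comment> \<open>Prepending \<open>i\<close> gives another admissible sequence, so its union is
      again bounded in measure by \<open>c\<close>.\<close>
    let ?s = "case_nat i s"
    let ?U = "\<Union>n. A (s n)"
    have eq: "(\<Union>n. A (?s n)) = ?U \<union> (A i - ?U)"
    proof (rule Set.set_eqI)
      fix \<omega>
      have "(\<exists>n. P n) \<longleftrightarrow> P 0 \<or> (\<exists>n. P (Suc n))" for P :: "nat \<Rightarrow> bool"
        by (metis not0_implies_Suc)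
      from this[of "\<lambda>n. \<omega> \<in> A (?s n)"]
      show "\<omega> \<in> (\<Union>n. A (?s n)) \<longleftrightarrow> \<omega> \<in> ?U \<union> (A i - ?U)" by auto
    qed
    have "?s n \<in> I" for n using s i by (cases n) (auto simp: S_def)
    then have "?s \<in> S" by (auto simp: S_def)
    from le_c[OF this] have "measure M (?U \<union> (A i - ?U)) \<le> m s" using c eq by (simp add: m_def)
    moreover have "measure M (?U \<union> (A i - ?U)) = m s + measure M (A i - ?U)"
      unfolding m_def by (rule finite_measure_Union) (use meas[OF s] A[OF i] in auto)
    ultimately have "measure M (A i - ?U) = 0"
      using measure_nonneg[of M "A i - ?U"] by linarith
    then have "A i - ?U \<in> null_sets M"
      using meas[OF s] A[OF i] by (intro null_setsI) (auto simp: emeasure_eq_measure)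
    from AE_not_in[OF this] show ?thesis by auto
  qed
  with s show thesis by (intro that) (auto simp: S_def)
qed

text \<open>For each rational level a countable subfamily exhausts all superlevel sets up to null
  sets. Merged over the rationals, these subfamilies suffice: if \<open>g i\<close> exceeded their
  supremum, a rational strictly between would give a contradiction.\<close>

lemma (in finite_measure) essential_supremum:
  fixes g :: "'i \<Rightarrow> 'a \<Rightarrow> ereal"
  assumes g: "\<And>i. i \<in> I \<Longrightarrow> g i \<in> borel_measurable M" and "I \<noteq> {}"
  obtains s :: "nat \<Rightarrow> 'i" where "range s \<subseteq> I"
    and "\<And>i. i \<in> I \<Longrightarrow> AE \<omega> in M. g i \<omega> \<le> (SUP n. g (s n) \<omega>)"
proof -
  define lev where "lev r i = {\<omega>\<in>space M. ereal (of_rat r) < g i \<omega>}" for r i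
  have lev: "lev r i \<in> sets M" if "i \<in> I" for r i
    unfolding lev_def using g[OF that] by measurable
  have "\<forall>r. \<exists>s :: nat \<Rightarrow> 'i. range s \<subseteq> I \<and>
      (\<forall>i\<in>I. AE \<omega> in M. \<omega> \<in> lev r i \<longrightarrow> \<omega> \<in> (\<Union>n. lev r (s n)))"
  proof
    fix r
    show "\<exists>s :: nat \<Rightarrow> 'i. range s \<subseteq> I \<and>
        (\<forall>i\<in>I. AE \<omega> in M. \<omega> \<in> lev r i \<longrightarrow> \<omega> \<in> (\<Union>n. lev r (s n)))"
      by (rule essential_union[of I "lev r", OF lev \<open>I \<noteq> {}\<close>]) auto
  qed
  from choice[OF this] obtain t :: "rat \<Rightarrow> nat \<Rightarrow> 'i" where t: "\<And>r. range (t r) \<subseteq> I"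
    "\<And>r i. i \<in> I \<Longrightarrow> AE \<omega> in M. \<omega> \<in> lev r i \<longrightarrow> \<omega> \<in> (\<Union>n. lev r (t r n))"
    by blast
  define s where "s n = t (from_nat (fst (prod_decode n))) (snd (prod_decode n))" for n
  have t_s: "t r n \<in> range s" for r n
    by (rule range_eqI[of _ _ "prod_encode (to_nat r, n)"]) (simp add: s_def)
  show thesis
  proof
    show "range s \<subseteq> I" using t(1) by (auto simp: s_def)
    fix i assume i: "i \<in> I"
    have "AE \<omega> in M. \<forall>r. \<omega> \<in> lev r i \<longrightarrow> \<omega> \<in> (\<Union>n. lev r (t r n))"
      unfolding AE_all_countable using t(2)[OF i] by blast
    then show "AE \<omega> in M. g i \<omega> \<le> (SUP n. g (s n) \<omega>)"
      using AE_space
    proof eventually_elim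
      case (elim \<omega>)
      show ?case
      proof (rule ccontr)
        assume "\<not> ?thesis"
        then have "(SUP n. g (s n) \<omega>) < g i \<omega>" by simp
        from ereal_dense3[OF this] obtain r :: rat where
          r: "(SUP n. g (s n) \<omega>) < ereal (of_rat r)" "ereal (of_rat r) < g i \<omega>" by auto
        with elim obtain n where "ereal (of_rat r) < g (t r n) \<omega>" by (auto simp: lev_def)
        moreover have "g (t r n) \<omega> \<le> (SUP n. g (s n) \<omega>)"
          using t_s[of r n] by (metis (no_types, lifting) SUP_upper UNIV_I imageE)
        ultimately show False using r(1) by simp
      qed
    qed
  qed
qed

text \<open>The supremum of the negated family is taken in \<open>ereal\<close>. The common lower
  bound \<open>l\<close> excludes one infinite value and nonemptiness the other, so passing back to
  reals changes only a null set.\<close>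

lemma (in finite_measure) essential_infimum_real:
  fixes g :: "'i \<Rightarrow> 'a \<Rightarrow> real"
  assumes g: "\<And>i. i \<in> I \<Longrightarrow> g i \<in> borel_measurable M" and "I \<noteq> {}"
    and l: "\<And>i. i \<in> I \<Longrightarrow> AE \<omega> in M. l \<omega> \<le> g i \<omega>"
  obtains h where "h \<in> borel_measurable M" "\<And>i. i \<in> I \<Longrightarrow> AE \<omega> in M. h \<omega> \<le> g i \<omega>"
    "\<And>k. (\<And>i. i \<in> I \<Longrightarrow> AE \<omega> in M. k \<omega> \<le> g i \<omega>) \<Longrightarrow> AE \<omega> in M. k \<omega> \<le> h \<omega>"
proof -
  have "(\<lambda>\<omega>. ereal (- g i \<omega>)) \<in> borel_measurable M" if "i \<in> I" for i
    using g[OF that] by measurable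
  from essential_supremum[of I "\<lambda>i \<omega>. ereal (- g i \<omega>)", OF this \<open>I \<noteq> {}\<close>] 
  obtain s :: "nat \<Rightarrow> 'i" where s: "range s \<subseteq> I"
    and ub: "\<And>i. i \<in> I \<Longrightarrow> AE \<omega> in M. ereal (- g i \<omega>) \<le> (SUP n. ereal (- g (s n) \<omega>))"
    by auto
  have sI: "s n \<in> I" for n using s by auto
  define u where "u \<omega> = (SUP n. ereal (- g (s n) \<omega>))" for \<omega>
  have [measurable]: "(\<lambda>\<omega>. ereal (- g (s n) \<omega>)) \<in> borel_measurable M" for n
    using g[OF sI[of n]] by measurable
  have u: "u \<in> borel_measurable M" unfolding u_def by measurable
  have below: "AE \<omega> in M. u \<omega> \<le> ereal (- k \<omega>)"
    if k: "\<And>i. i \<in> I \<Longrightarrow> AE \<omega> in M. k \<omega> \<le> g i \<omega>" for k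
  proof -
    have "AE \<omega> in M. \<forall>n. k \<omega> \<le> g (s n) \<omega>"
      unfolding AE_all_countable using k sI by blast
    then show ?thesis by eventually_elim (auto simp: u_def intro: SUP_least)
  qed
  have "AE \<omega> in M. u \<omega> \<le> ereal (- l \<omega>)" by (rule below) (rule l)
  then have "AE \<omega> in M. u \<omega> \<noteq> \<infinity>" by eventually_elim auto
  moreover have "AE \<omega> in M. u \<omega> \<noteq> -\<infinity>"
    using ub[OF sI[of 0]] by eventually_elim (auto simp: u_def)
  ultimately have fin: "AE \<omega> in M. ereal (real_of_ereal (u \<omega>)) = u \<omega>"
    by eventually_elim (auto simp: ereal_real)
  show thesis
  proof
    show "(\<lambda>\<omega>. - real_of_ereal (u \<omega>)) \<in> borel_measurable M" using u by measurable
    show "AE \<omega> in M. - real_of_ereal (u \<omega>) \<le> g i \<omega>" if "i \<in> I" for i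
      using ub[OF that] fin
    proof eventually_elim
      case (elim \<omega>)
      then have "ereal (- g i \<omega>) \<le> ereal (real_of_ereal (u \<omega>))" by (simp add: u_def)
      then show ?case by simp
    qed
    fix k assume "\<And>i. i \<in> I \<Longrightarrow> AE \<omega> in M. k \<omega> \<le> g i \<omega>"
    then have "AE \<omega> in M. u \<omega> \<le> ereal (- k \<omega>)" by (rule below)
    then show "AE \<omega> in M. k \<omega> \<le> - real_of_ereal (u \<omega>)"
      using fin
    proof eventually_elim
      case (elim \<omega>)
      then have "ereal (real_of_ereal (u \<omega>)) \<le> ereal (- k \<omega>)" by simp
      then show ?case by simp
    qed
  qed
qed

text \<open>The supremum in the lattice is a choice of some least upper bound, so nothing can be
  said of it before one is known to exist. The set in the theorem may be uncountable; a countable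
  subfamily with the same essential supremum gives a pointwise candidate.\<close>

lemma (in finite_measure) L0_bar_Sup_least:
  assumes S: "S \<subseteq> L0 M" and "S \<noteq> {}"
  shows "least (L0_bar M) (\<Squnion>\<^bsub>L0_bar M\<^esub>S) (Upper (L0_bar M) S)"
proof -
  interpret partial_order "L0_bar M" by (rule partial_order_L0_bar)
  have rep: "rv_rep a \<in> borel_measurable M" if "a \<in> S" for a using that S by (auto simp: L0_rep)
  obtain s :: "nat \<Rightarrow> ('a \<Rightarrow> ereal) set" where s: "range s \<subseteq> S"
    and ub: "\<And>a. a \<in> S \<Longrightarrow> AE \<omega> in M. rv_rep a \<omega> \<le> (SUP n. rv_rep (s n) \<omega>)"
    using essential_supremum[of S rv_rep, OF rep \<open>S \<noteq> {}\<close>] by blast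
  have sS: "s n \<in> S" for n using s by auto
  have sL: "s n \<in> L0 M" for n using sS S by blast
  define u where "u = (\<lambda>\<omega>. SUP n. rv_rep (s n) \<omega>)"
  have u: "u \<in> borel_measurable M"
    unfolding u_def by (intro borel_measurable_SUP rep sS) auto
  have lub: "least (L0_bar M) (rv_class M u) (Upper (L0_bar M) S)"
  proof (rule least_UpperI)
    fix a assume a: "a \<in> S"
    have "AE \<omega> in M. rv_rep a \<omega> \<le> rv_rep (rv_class M u) \<omega>"
      using ub[OF a] rv_rep_class(2)[OF u] by eventually_elim (simp add: u_def)
    then show "a \<sqsubseteq>\<^bsub>L0_bar M\<^esub> rv_class M u" using a S u by (auto simp: L0_bar_le_iff)
  next
    fix b assume "b \<in> Upper (L0_bar M) S"
    then have b: "b \<in> L0 M" and le: "\<And>n. s n \<sqsubseteq>\<^bsub>L0_bar M\<^esub> b"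
      using sS sL by (auto simp: Upper_def)
    have "AE \<omega> in M. \<forall>n. rv_rep (s n) \<omega> \<le> rv_rep b \<omega>"
      unfolding AE_all_countable using le L0_bar_le_iff[OF sL b] by auto
    then have "AE \<omega> in M. rv_rep (rv_class M u) \<omega> \<le> rv_rep b \<omega>"
      using rv_rep_class(2)[OF u] by eventually_elim (auto simp: u_def intro: SUP_least)
    then show "rv_class M u \<sqsubseteq>\<^bsub>L0_bar M\<^esub> b" using b u by (simp add: L0_bar_le_iff)
  qed (use S u in auto)
  show ?thesis unfolding Lattice.sup_def by (rule someI[where P="\<lambda>x. least _ x _", OF lub])
qed


section \<open>A Hahn-Banach theorem for functionals with values in random variables\<close>

text \<open>A relation rather than a function, because a version of the infimum is determined only
  up to a null set.\<close>

definition ess_inf_of :: "'a measure \<Rightarrow> 'i set \<Rightarrow> ('i \<Rightarrow> 'a \<Rightarrow> real) \<Rightarrow> ('a \<Rightarrow> real) \<Rightarrow> bool" where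
  "ess_inf_of M I g h \<longleftrightarrow> h \<in> borel_measurable M \<and> (\<forall>i\<in>I. AE \<omega> in M. h \<omega> \<le> g i \<omega>) \<and>
    (\<forall>k. (\<forall>i\<in>I. AE \<omega> in M. k \<omega> \<le> g i \<omega>) \<longrightarrow> (AE \<omega> in M. k \<omega> \<le> h \<omega>))"

text \<open>Homogeneity is required for the scalar 2 only: this suffices to make minimal functions additive,
  and homogeneity over \<open>L\<^sup>0\<close> comes for free at the end. Values are functions rather than classes, so
  all relations hold almost everywhere; the upper bound for \<open>\<psi> (z + z)\<close> is subadditivity.\<close>

definition dyadic_sublinear ::
    "'a measure \<Rightarrow> ('e, 'm) ring_scheme \<Rightarrow> ('e \<Rightarrow> 'a \<Rightarrow> real) \<Rightarrow> bool" where
  "dyadic_sublinear M G \<psi> \<longleftrightarrow>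
    (\<forall>z\<in>carrier G. \<psi> z \<in> borel_measurable M) \<and>
    (\<forall>z\<in>carrier G. \<forall>w\<in>carrier G. AE \<omega> in M. \<psi> (z \<oplus>\<^bsub>G\<^esub> w) \<omega> \<le> \<psi> z \<omega> + \<psi> w \<omega>) \<and>
    (\<forall>z\<in>carrier G. AE \<omega> in M. 2 * \<psi> z \<omega> \<le> \<psi> (z \<oplus>\<^bsub>G\<^esub> z) \<omega>)"

text \<open>The indices vary independently: with \<open>j\<close> fixed, the infimum over
  \<open>i\<close> can be taken, and then the infimum over \<open>j\<close>.\<close>

lemma ess_inf_of_add:
  assumes h: "ess_inf_of M I g h" and h': "ess_inf_of M J g' h'"
    and le: "\<And>i j. i \<in> I \<Longrightarrow> j \<in> J \<Longrightarrow> AE \<omega> in M. k \<omega> \<le> g i \<omega> + g' j \<omega>"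
  shows "AE \<omega> in M. k \<omega> \<le> h \<omega> + h' \<omega>"
proof -
  have "AE \<omega> in M. k \<omega> - h \<omega> \<le> g' j \<omega>" if j: "j \<in> J" for j
  proof -
    have "AE \<omega> in M. k \<omega> - g' j \<omega> \<le> g i \<omega>" if "i \<in> I" for i
      using le[OF that j] by eventually_elim simp
    then have "AE \<omega> in M. k \<omega> - g' j \<omega> \<le> h \<omega>" using h by (auto simp: ess_inf_of_def)
    then show ?thesis by eventually_elim simp
  qed
  then have "AE \<omega> in M. k \<omega> - h \<omega> \<le> h' \<omega>" using h' by (auto simp: ess_inf_of_def)
  then show ?thesis by eventually_elim simp
qed

text \<open>The members of the family need not be sublinear themselves; it is enough that each
  inequality holds after moving to another index. The lemma serves the descending sequence that
  shifts by a vector, the chains of Zorn's lemma, and the cone spanned by the translated convex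
  set.\<close>

lemma (in finite_measure) dyadic_sublinear_infimum:
  assumes G: "abelian_group G" and "I \<noteq> {}"
    and meas: "\<And>i z. i \<in> I \<Longrightarrow> z \<in> carrier G \<Longrightarrow> a i z \<in> borel_measurable M"
    and low: "\<And>i z. i \<in> I \<Longrightarrow> z \<in> carrier G \<Longrightarrow> AE \<omega> in M. l z \<omega> \<le> a i z \<omega>"
    and add: "\<And>i j z w. i \<in> I \<Longrightarrow> j \<in> I \<Longrightarrow> z \<in> carrier G \<Longrightarrow> w \<in> carrier G \<Longrightarrow>
      \<exists>k\<in>I. AE \<omega> in M. a k (z \<oplus>\<^bsub>G\<^esub> w) \<omega> \<le> a i z \<omega> + a j w \<omega>"
    and dbl: "\<And>i z. i \<in> I \<Longrightarrow> z \<in> carrier G \<Longrightarrow>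
      \<exists>j\<in>I. AE \<omega> in M. 2 * a j z \<omega> \<le> a i (z \<oplus>\<^bsub>G\<^esub> z) \<omega>"
  obtains \<psi> where "dyadic_sublinear M G \<psi>"
    and "\<And>i z. i \<in> I \<Longrightarrow> z \<in> carrier G \<Longrightarrow> AE \<omega> in M. \<psi> z \<omega> \<le> a i z \<omega>"
proof -
  interpret G: abelian_group G by (rule G)
  have "\<exists>h. ess_inf_of M I (\<lambda>i. a i z) h" if z: "z \<in> carrier G" for z
    by (rule essential_infimum_real[of I "\<lambda>i. a i z" "l z", OF meas[OF _ z] \<open>I \<noteq> {}\<close> low[OF _ z]])
      (auto simp: ess_inf_of_def)
  then obtain \<psi> where \<psi>: "\<And>z. z \<in> carrier G \<Longrightarrow> ess_inf_of M I (\<lambda>i. a i z) (\<psi> z)"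
    by metis
  then have m: "\<psi> z \<in> borel_measurable M" if "z \<in> carrier G" for z
    using \<psi>[OF that] by (auto simp: ess_inf_of_def)
  have le: "AE \<omega> in M. \<psi> z \<omega> \<le> a i z \<omega>" if "z \<in> carrier G" "i \<in> I" for z i
    using that \<psi> by (auto simp: ess_inf_of_def)
  show thesis
  proof
    show "dyadic_sublinear M G \<psi>"
      unfolding dyadic_sublinear_def
    proof (intro conjI ballI)
      fix z w assume zw: "z \<in> carrier G" "w \<in> carrier G"
      show "AE \<omega> in M. \<psi> (z \<oplus>\<^bsub>G\<^esub> w) \<omega> \<le> \<psi> z \<omega> + \<psi> w \<omega>"
      proof (rule ess_inf_of_add[OF \<psi>[OF zw(1)] \<psi>[OF zw(2)]])
        fix i j assume "i \<in> I" "j \<in> I"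
        then obtain k where "k \<in> I" and k: "AE \<omega> in M. a k (z \<oplus>\<^bsub>G\<^esub> w) \<omega> \<le> a i z \<omega> + a j w \<omega>"
          using add zw by blast
        then show "AE \<omega> in M. \<psi> (z \<oplus>\<^bsub>G\<^esub> w) \<omega> \<le> a i z \<omega> + a j w \<omega>"
          using le[of "z \<oplus>\<^bsub>G\<^esub> w" k] zw by auto
      qed
    next
      fix z assume z: "z \<in> carrier G"
      have "AE \<omega> in M. 2 * \<psi> z \<omega> \<le> a i (z \<oplus>\<^bsub>G\<^esub> z) \<omega>" if i: "i \<in> I" for i
      proof -
        obtain j where "j \<in> I" and j: "AE \<omega> in M. 2 * a j z \<omega> \<le> a i (z \<oplus>\<^bsub>G\<^esub> z) \<omega>"
          using dbl i z by blast
        from j le[OF z \<open>j \<in> I\<close>] show ?thesis by eventually_elim linarith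
      qed
      then show "AE \<omega> in M. 2 * \<psi> z \<omega> \<le> \<psi> (z \<oplus>\<^bsub>G\<^esub> z) \<omega>"
        using \<psi>[of "z \<oplus>\<^bsub>G\<^esub> z"] z by (auto simp: ess_inf_of_def)
    qed (use m in auto)
  qed (use le in auto)
qed

text \<open>At zero, subadditivity forces a nonnegative value and the doubling inequality a
  nonpositive one.\<close>

lemma dyadic_sublinear_zero:
  assumes "abelian_group G" and \<psi>: "dyadic_sublinear M G \<psi>"
  shows "AE \<omega> in M. \<psi> \<zero>\<^bsub>G\<^esub> \<omega> = 0"
proof -
  interpret G: abelian_group G by fact
  have "AE \<omega> in M. \<psi> (\<zero>\<^bsub>G\<^esub> \<oplus>\<^bsub>G\<^esub> \<zero>\<^bsub>G\<^esub>) \<omega> \<le> \<psi> \<zero>\<^bsub>G\<^esub> \<omega> + \<psi> \<zero>\<^bsub>G\<^esub> \<omega>"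
    "AE \<omega> in M. 2 * \<psi> \<zero>\<^bsub>G\<^esub> \<omega> \<le> \<psi> (\<zero>\<^bsub>G\<^esub> \<oplus>\<^bsub>G\<^esub> \<zero>\<^bsub>G\<^esub>) \<omega>"
    using \<psi> G.zero_closed unfolding dyadic_sublinear_def by blast+
  then show ?thesis by eventually_elim simp
qed

text \<open>Subadditivity applied to w = - z + (z + w). This is the source of the lower bounds that
  keep all infima finite.\<close>

lemma dyadic_sublinear_diff:
  assumes "abelian_group G" and \<psi>: "dyadic_sublinear M G \<psi>"
    and z: "z \<in> carrier G" and w: "w \<in> carrier G"
  shows "AE \<omega> in M. \<psi> w \<omega> - \<psi> (\<ominus>\<^bsub>G\<^esub> z) \<omega> \<le> \<psi> (z \<oplus>\<^bsub>G\<^esub> w) \<omega>"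
proof -
  interpret G: abelian_group G by fact
  have "AE \<omega> in M. \<psi> (\<ominus>\<^bsub>G\<^esub> z \<oplus>\<^bsub>G\<^esub> (z \<oplus>\<^bsub>G\<^esub> w)) \<omega> \<le> \<psi> (\<ominus>\<^bsub>G\<^esub> z) \<omega> + \<psi> (z \<oplus>\<^bsub>G\<^esub> w) \<omega>"
    using \<psi> z w G.a_inv_closed G.add.m_closed unfolding dyadic_sublinear_def by blast
  moreover have "\<ominus>\<^bsub>G\<^esub> z \<oplus>\<^bsub>G\<^esub> (z \<oplus>\<^bsub>G\<^esub> w) = w" using z w by (simp add: G.r_neg1)
  ultimately show ?thesis by (simp add: algebra_simps)
qed

text \<open>\<open>\<psi>'\<close> is the infimum of \<open>\<psi> (z + 2\<^sup>k x) - 2\<^sup>k \<psi> x\<close> over \<open>k\<close>, which decreases in \<open>k\<close>.\<close>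

lemma (in finite_measure) dyadic_sublinear_step:
  assumes G: "abelian_group G" and \<psi>: "dyadic_sublinear M G \<psi>" and x: "x \<in> carrier G"
  obtains \<psi>' where "dyadic_sublinear M G \<psi>'"
    and "\<And>z. z \<in> carrier G \<Longrightarrow> AE \<omega> in M. \<psi>' z \<omega> \<le> \<psi> z \<omega>"
    and "\<And>z. z \<in> carrier G \<Longrightarrow> AE \<omega> in M. \<psi>' z \<omega> \<le> \<psi> (z \<oplus>\<^bsub>G\<^esub> x) \<omega> - \<psi> x \<omega>"
proof -
  interpret G: abelian_group G by (rule G)
  have m: "\<psi> z \<in> borel_measurable M" if "z \<in> carrier G" for z
    using \<psi> that by (simp add: dyadic_sublinear_def)
  have sub: "AE \<omega> in M. \<psi> (z \<oplus>\<^bsub>G\<^esub> w) \<omega> \<le> \<psi> z \<omega> + \<psi> w \<omega>" if "z \<in> carrier G" "w \<in> carrier G" for z w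
    using \<psi> that by (simp add: dyadic_sublinear_def)
  have dbl: "AE \<omega> in M. 2 * \<psi> z \<omega> \<le> \<psi> (z \<oplus>\<^bsub>G\<^esub> z) \<omega>" if "z \<in> carrier G" for z
    using \<psi> that by (simp add: dyadic_sublinear_def)
  \<comment> \<open>\<open>d k\<close> is 2^k x; a bare abelian group offers repeated doubling in
    place of scalar multiplication.\<close>
  define d where "d k = ((\<lambda>z. z \<oplus>\<^bsub>G\<^esub> z) ^^ k) x" for k :: nat
  have d0: "d 0 = x" and dS: "d (Suc k) = d k \<oplus>\<^bsub>G\<^esub> d k" for k by (simp_all add: d_def)
  have d: "d k \<in> carrier G" for k by (induction k) (simp_all add: d0 dS x)
  \<comment> \<open>Subadditivity and the doubling inequality together make \<open>\<psi>\<close>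
    exactly homogeneous along the powers of two.\<close>
  have pd: "AE \<omega> in M. \<psi> (d k) \<omega> = 2 ^ k * \<psi> x \<omega>" for k
  proof (induction k)
    case (Suc k)
    from this sub[OF d[of k] d[of k]] dbl[OF d[of k]] show ?case
      by eventually_elim (simp add: dS mult_ac)
  qed (simp add: d0)
  define a where "a k z \<omega> = \<psi> (z \<oplus>\<^bsub>G\<^esub> d k) \<omega> - 2 ^ k * \<psi> x \<omega>" for k z \<omega>
  have am: "a k z \<in> borel_measurable M" if "z \<in> carrier G" for k z
    unfolding a_def using m[OF x] m[OF G.add.m_closed[OF that d[of k]]] by measurable
  have mono1: "AE \<omega> in M. a (Suc k) z \<omega> \<le> a k z \<omega>" if z: "z \<in> carrier G" for k z
  proof -
    have "z \<oplus>\<^bsub>G\<^esub> d (Suc k) = (z \<oplus>\<^bsub>G\<^esub> d k) \<oplus>\<^bsub>G\<^esub> d k" using z d by (simp add: dS G.a_assoc)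
    with sub[of "z \<oplus>\<^bsub>G\<^esub> d k" "d k"] z d
    have "AE \<omega> in M. \<psi> (z \<oplus>\<^bsub>G\<^esub> d (Suc k)) \<omega> \<le> \<psi> (z \<oplus>\<^bsub>G\<^esub> d k) \<omega> + \<psi> (d k) \<omega>" by simp
    with pd[of k] show ?thesis by eventually_elim (simp add: a_def algebra_simps)
  qed
  have mono: "AE \<omega> in M. a (k + n) z \<omega> \<le> a k z \<omega>" if z: "z \<in> carrier G" for k n z
  proof (induction n)
    case (Suc n)
    from this mono1[OF z, of "k + n"] show ?case by eventually_elim simp
  qed simp
  have mono': "AE \<omega> in M. a k z \<omega> \<le> a j z \<omega>" if "z \<in> carrier G" "j \<le> k" for j k z
    using mono[OF that(1), of j "k - j"] that by simp
  have low: "AE \<omega> in M. - \<psi> (\<ominus>\<^bsub>G\<^esub> z) \<omega> \<le> a k z \<omega>" if z: "z \<in> carrier G" for k z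
    using dyadic_sublinear_diff[OF G \<psi> z d[of k]] pd[of k] by eventually_elim (simp add: a_def)
  have perm: "(z \<oplus>\<^bsub>G\<^esub> w) \<oplus>\<^bsub>G\<^esub> d (Suc k) = (z \<oplus>\<^bsub>G\<^esub> d k) \<oplus>\<^bsub>G\<^esub> (w \<oplus>\<^bsub>G\<^esub> d k)"
    if "z \<in> carrier G" "w \<in> carrier G" for z w k
    using that d by (simp add: dS G.add.m_ac)
  obtain \<psi>' where "dyadic_sublinear M G \<psi>'"
    and \<psi>': "\<And>i z. i \<in> (UNIV :: nat set) \<Longrightarrow> z \<in> carrier G \<Longrightarrow> AE \<omega> in M. \<psi>' z \<omega> \<le> a i z \<omega>"
  proof (rule dyadic_sublinear_infimum[OF G, of UNIV a "\<lambda>z \<omega>. - \<psi> (\<ominus>\<^bsub>G\<^esub> z) \<omega>"])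
    fix i j :: nat and z w assume zw: "z \<in> carrier G" "w \<in> carrier G"
    let ?k = "max i j"
    \<comment> \<open>Both indices are first raised to their maximum, which only decreases the
      terms. Two copies of 2^k x then combine to 2^(k+1) x, hence the successor.\<close>
    have "AE \<omega> in M. a (Suc ?k) (z \<oplus>\<^bsub>G\<^esub> w) \<omega> \<le> a ?k z \<omega> + a ?k w \<omega>"
      using sub[of "z \<oplus>\<^bsub>G\<^esub> d ?k" "w \<oplus>\<^bsub>G\<^esub> d ?k"] zw d
      unfolding perm[OF zw, symmetric] by (simp add: a_def algebra_simps)
    with mono'[OF zw(1) max.cobounded1[of i j]] mono'[OF zw(2) max.cobounded2[of j i]]
    have "AE \<omega> in M. a (Suc ?k) (z \<oplus>\<^bsub>G\<^esub> w) \<omega> \<le> a i z \<omega> + a j w \<omega>"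
      by eventually_elim linarith
    then show "\<exists>k\<in>UNIV. AE \<omega> in M. a k (z \<oplus>\<^bsub>G\<^esub> w) \<omega> \<le> a i z \<omega> + a j w \<omega>" by blast
  next
    fix i :: nat and z assume z: "z \<in> carrier G"
    \<comment> \<open>Doubling raises the index by one; monotonicity in the index brings it back to
      \<open>i\<close>, so \<open>i\<close> itself is the witness.\<close>
    have "AE \<omega> in M. 2 * \<psi> (z \<oplus>\<^bsub>G\<^esub> d i) \<omega> \<le> \<psi> ((z \<oplus>\<^bsub>G\<^esub> z) \<oplus>\<^bsub>G\<^esub> d (Suc i)) \<omega>"
      using dbl[of "z \<oplus>\<^bsub>G\<^esub> d i"] z d unfolding perm[OF z z] by simp
    moreover have "AE \<omega> in M. a (Suc i) (z \<oplus>\<^bsub>G\<^esub> z) \<omega> \<le> a i (z \<oplus>\<^bsub>G\<^esub> z) \<omega>"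
      using mono1 z by simp
    ultimately have "AE \<omega> in M. 2 * a i z \<omega> \<le> a i (z \<oplus>\<^bsub>G\<^esub> z) \<omega>"
      by eventually_elim (simp add: a_def algebra_simps)
    then show "\<exists>j\<in>UNIV. AE \<omega> in M. 2 * a j z \<omega> \<le> a i (z \<oplus>\<^bsub>G\<^esub> z) \<omega>" by blast
  qed (use am low in auto)
  show thesis
  proof
    fix z assume z: "z \<in> carrier G"
    show "AE \<omega> in M. \<psi>' z \<omega> \<le> \<psi> (z \<oplus>\<^bsub>G\<^esub> x) \<omega> - \<psi> x \<omega>"
      \<comment> \<open>Index 0 is the shift by \<open>x\<close> itself.\<close>
      using \<psi>'[OF _ z, of 0] by (simp add: a_def d0)
    with sub[OF z x] show "AE \<omega> in M. \<psi>' z \<omega> \<le> \<psi> z \<omega>" by eventually_elim simp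
  qed fact
qed

text \<open>For a minimal \<open>f\<close>, shifting by \<open>w\<close> produces a sublinear
  function below \<open>f\<close>, which by minimality is not smaller. Hence f z <= f (z + w) - f w,
  the reverse of subadditivity.\<close>

lemma (in finite_measure) hahn_banach_L0:
  assumes G: "abelian_group G" and \<phi>: "dyadic_sublinear M G \<phi>"
  obtains f where "\<And>z. z \<in> carrier G \<Longrightarrow> f z \<in> borel_measurable M"
    and "\<And>z w. z \<in> carrier G \<Longrightarrow> w \<in> carrier G \<Longrightarrow> AE \<omega> in M. f (z \<oplus>\<^bsub>G\<^esub> w) \<omega> = f z \<omega> + f w \<omega>"
    and "\<And>z. z \<in> carrier G \<Longrightarrow> AE \<omega> in M. f z \<omega> \<le> \<phi> z \<omega>"
proof -
  interpret G: abelian_group G by (rule G)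
  \<comment> \<open>Fixing representatives turns the almost sure preorder into an order, as Zorn's lemma requires.\<close>
  define canon where "canon \<psi> z = (if z \<in> carrier G then rv_rep (rv_class M (\<psi> z)) else (\<lambda>_. 0))"
    for \<psi> :: "'b \<Rightarrow> 'a \<Rightarrow> real" and z
  \<comment> \<open>The order is reversed: larger means pointwise smaller, so the maximal element
    given by Zorn's lemma is a minimal sublinear function.\<close>
  define le where "le a b \<longleftrightarrow> (\<forall>z\<in>carrier G. AE \<omega> in M. b z \<omega> \<le> a z \<omega>)"
    for a b :: "'b \<Rightarrow> 'a \<Rightarrow> real"
  have le_trans: "le a c" if "le a b" "le b c" for a b c
    unfolding le_def
  proof
    fix z assume "z \<in> carrier G"
    then have "AE \<omega> in M. b z \<omega> \<le> a z \<omega>" "AE \<omega> in M. c z \<omega> \<le> b z \<omega>"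
      using that by (auto simp: le_def)
    then show "AE \<omega> in M. c z \<omega> \<le> a z \<omega>" by eventually_elim simp
  qed
  \<comment> \<open>Off the carrier \<open>canon\<close> is constantly zero, so agreement almost
    everywhere on the carrier already yields equal functions.\<close>
  have canon_eq: "canon a = canon b" if "le a b" "le b a" for a b
  proof -
    have "rv_class M (a z) = rv_class M (b z)" if z: "z \<in> carrier G" for z
    proof (rule rv_class_cong)
      have "AE \<omega> in M. b z \<omega> \<le> a z \<omega>" "AE \<omega> in M. a z \<omega> \<le> b z \<omega>"
        using z \<open>le a b\<close> \<open>le b a\<close> by (auto simp: le_def)
      then show "AE \<omega> in M. a z \<omega> = b z \<omega>" by eventually_elim simp
    qed
    then show ?thesis by (auto simp: canon_def fun_eq_iff)
  qed
  have canon: "canon \<psi> z \<in> borel_measurable M" "AE \<omega> in M. canon \<psi> z \<omega> = \<psi> z \<omega>"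
    if "dyadic_sublinear M G \<psi>" "z \<in> carrier G" for \<psi> z
    using that rv_rep_class[of "\<psi> z" M] by (auto simp: canon_def dyadic_sublinear_def)
  have canon_le: "le \<psi> (canon \<psi>)" "le (canon \<psi>) \<psi>" if "dyadic_sublinear M G \<psi>" for \<psi>
  proof -
    have "AE \<omega> in M. canon \<psi> z \<omega> \<le> \<psi> z \<omega> \<and> \<psi> z \<omega> \<le> canon \<psi> z \<omega>" if "z \<in> carrier G" for z
      using canon(2)[OF \<open>dyadic_sublinear M G \<psi>\<close> that] by eventually_elim simp
    then show "le \<psi> (canon \<psi>)" "le (canon \<psi>) \<psi>" by (auto simp: le_def)
  qed
  have canon_sub: "dyadic_sublinear M G (canon \<psi>)" if s: "dyadic_sublinear M G \<psi>" for \<psi>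
    unfolding dyadic_sublinear_def
  proof (intro conjI ballI)
    fix z w assume zw: "z \<in> carrier G" "w \<in> carrier G"
    have "AE \<omega> in M. \<psi> (z \<oplus>\<^bsub>G\<^esub> w) \<omega> \<le> \<psi> z \<omega> + \<psi> w \<omega>"
      using s zw by (simp add: dyadic_sublinear_def)
    with canon(2)[OF s zw(1)] canon(2)[OF s zw(2)] canon(2)[OF s G.add.m_closed[OF zw]]
    show "AE \<omega> in M. canon \<psi> (z \<oplus>\<^bsub>G\<^esub> w) \<omega> \<le> canon \<psi> z \<omega> + canon \<psi> w \<omega>"
      by eventually_elim simp
  next
    fix z assume z: "z \<in> carrier G"
    have "AE \<omega> in M. 2 * \<psi> z \<omega> \<le> \<psi> (z \<oplus>\<^bsub>G\<^esub> z) \<omega>"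
      using s z by (simp add: dyadic_sublinear_def)
    with canon(2)[OF s z] canon(2)[OF s G.add.m_closed[OF z z]]
    show "AE \<omega> in M. 2 * canon \<psi> z \<omega> \<le> canon \<psi> (z \<oplus>\<^bsub>G\<^esub> z) \<omega>"
      by eventually_elim simp
  qed (use canon(1)[OF s] in auto)
  define A where "A = {\<psi>. dyadic_sublinear M G \<psi> \<and> le \<phi> \<psi> \<and> canon \<psi> = \<psi>}"
  have canon_idem: "canon (canon \<psi>) = canon \<psi>" if "dyadic_sublinear M G \<psi>" for \<psi>
    using canon_eq canon_le that by blast
  have canon_A: "canon \<psi> \<in> A" if "dyadic_sublinear M G \<psi>" "le \<phi> \<psi>" for \<psi>
    using that canon_sub canon_idem canon_le le_trans unfolding A_def by blast
  have "\<exists>m\<in>A. \<forall>a\<in>A. le m a \<longrightarrow> a = m"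
  proof (rule predicate_Zorn)
    have refl: "le a a" for a by (simp add: le_def)
    show "partial_order_on A (relation_of le A)"
    proof (rule partial_order_on_relation_ofI)
      show "a = b" if "a \<in> A" "b \<in> A" "le a b" "le b a" for a b
        using canon_eq[OF that(3,4)] that(1,2) by (simp add: A_def)
    qed (use refl le_trans in blast)+
    fix C assume "C \<in> Chains (relation_of le A)"
    then have CA: "C \<subseteq> A" and tot: "\<And>a b. a \<in> C \<Longrightarrow> b \<in> C \<Longrightarrow> le a b \<or> le b a"
      by (auto simp: Chains_def relation_of_def)
    show "\<exists>u\<in>A. \<forall>a\<in>C. le a u"
    proof (cases "C = {}")
      case True
      have "le \<phi> \<phi>" by (rule refl)
      from canon_A[OF \<phi> this] True show ?thesis by blast
    next
      case False
      then obtain c0 where c0: "c0 \<in> C" by blast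
      have sl: "dyadic_sublinear M G c" if "c \<in> C" for c using that CA by (auto simp: A_def)
      obtain u where u: "dyadic_sublinear M G u"
        and uC: "\<And>c z. c \<in> C \<Longrightarrow> z \<in> carrier G \<Longrightarrow> AE \<omega> in M. u z \<omega> \<le> c z \<omega>"
      \<comment> \<open>One fixed member \<open>c0\<close> bounds the whole chain from below. If
        \<open>c\<close> is above \<open>c0\<close> pointwise, then c z >= c0 z >= - c0 (- z); if it
        is below, then c z >= - c (- z) >= - c0 (- z).\<close>
      proof (rule dyadic_sublinear_infimum[OF G False,
            of "\<lambda>c. c" "\<lambda>z \<omega>. - c0 (\<ominus>\<^bsub>G\<^esub> z) \<omega>"])
        fix c z assume c: "c \<in> C" and z: "z \<in> carrier G"
        show "c z \<in> borel_measurable M" using sl[OF c] z by (simp add: dyadic_sublinear_def)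
        show "\<exists>b\<in>C. AE \<omega> in M. 2 * b z \<omega> \<le> c (z \<oplus>\<^bsub>G\<^esub> z) \<omega>"
          using sl[OF c] z by (intro bexI[OF _ c]) (simp add: dyadic_sublinear_def)
        have neg: "AE \<omega> in M. - b (\<ominus>\<^bsub>G\<^esub> z) \<omega> \<le> b z \<omega>" if "b \<in> C" for b
          using dyadic_sublinear_diff[OF G sl[OF that] z G.zero_closed]
            dyadic_sublinear_zero[OF G sl[OF that]]
          by eventually_elim (simp add: z)
        from tot[OF c c0] show "AE \<omega> in M. - c0 (\<ominus>\<^bsub>G\<^esub> z) \<omega> \<le> c z \<omega>"
        proof
          assume "le c c0"
          then have "AE \<omega> in M. c0 z \<omega> \<le> c z \<omega>" using z by (simp add: le_def)
          with neg[OF c0] show ?thesis by eventually_elim simp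
        next
          assume "le c0 c"
          then have "AE \<omega> in M. c (\<ominus>\<^bsub>G\<^esub> z) \<omega> \<le> c0 (\<ominus>\<^bsub>G\<^esub> z) \<omega>" using z by (simp add: le_def)
          with neg[OF c] show ?thesis by eventually_elim simp
        qed
      next
        fix b c z w assume bc: "b \<in> C" "c \<in> C" and zw: "z \<in> carrier G" "w \<in> carrier G"
        from tot[OF bc] show "\<exists>k\<in>C. AE \<omega> in M. k (z \<oplus>\<^bsub>G\<^esub> w) \<omega> \<le> b z \<omega> + c w \<omega>"
        proof
          assume "le b c"
          then have "AE \<omega> in M. c z \<omega> \<le> b z \<omega>" using zw by (simp add: le_def)
          moreover have "AE \<omega> in M. c (z \<oplus>\<^bsub>G\<^esub> w) \<omega> \<le> c z \<omega> + c w \<omega>"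
            using sl[OF bc(2)] zw by (simp add: dyadic_sublinear_def)
          ultimately have "AE \<omega> in M. c (z \<oplus>\<^bsub>G\<^esub> w) \<omega> \<le> b z \<omega> + c w \<omega>"
            by eventually_elim simp
          with bc show ?thesis by blast
        next
          assume "le c b"
          then have "AE \<omega> in M. b w \<omega> \<le> c w \<omega>" using zw by (simp add: le_def)
          moreover have "AE \<omega> in M. b (z \<oplus>\<^bsub>G\<^esub> w) \<omega> \<le> b z \<omega> + b w \<omega>"
            using sl[OF bc(1)] zw by (simp add: dyadic_sublinear_def)
          ultimately have "AE \<omega> in M. b (z \<oplus>\<^bsub>G\<^esub> w) \<omega> \<le> b z \<omega> + c w \<omega>"
            by eventually_elim simp
          with bc show ?thesis by blast
        qed
      qed blast
      have Cu: "le c u" if "c \<in> C" for c using uC that by (simp add: le_def)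
      have "le \<phi> c0" using c0 CA by (auto simp: A_def)
      then have "canon u \<in> A" using canon_A[OF u] Cu[OF c0] le_trans by blast
      moreover have "le c (canon u)" if "c \<in> C" for c
        using le_trans Cu[OF that] canon_le[OF u] by blast
      ultimately show ?thesis by blast
    qed
  qed
  then obtain f where f: "dyadic_sublinear M G f" "le \<phi> f" "canon f = f"
    and min: "\<And>a. a \<in> A \<Longrightarrow> le f a \<Longrightarrow> a = f"
    by (auto simp: A_def)
  \<comment> \<open>Minimality is known only among canonical versions; passing to
    \<open>canon a\<close> extends it to every sublinear function below \<open>f\<close>.\<close>
  have f_min: "le a f" if a: "dyadic_sublinear M G a" "le f a" for a
  proof -
    have "canon a \<in> A" using canon_A[OF a(1)] le_trans[OF f(2) a(2)] by blast
    moreover have "le f (canon a)" using le_trans[OF a(2) canon_le(1)[OF a(1)]] .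
    ultimately have "canon a = f" by (rule min)
    with canon_le(1)[OF a(1)] show ?thesis by simp
  qed
  show thesis
  proof
    fix z w assume zw: "z \<in> carrier G" "w \<in> carrier G"
    obtain \<psi>' where \<psi>': "dyadic_sublinear M G \<psi>'"
      "\<And>z. z \<in> carrier G \<Longrightarrow> AE \<omega> in M. \<psi>' z \<omega> \<le> f z \<omega>"
      "\<And>z. z \<in> carrier G \<Longrightarrow> AE \<omega> in M. \<psi>' z \<omega> \<le> f (z \<oplus>\<^bsub>G\<^esub> w) \<omega> - f w \<omega>"
      using dyadic_sublinear_step[OF G f(1) zw(2)] by blast
    have "le f \<psi>'" using \<psi>'(2) by (simp add: le_def)
    from f_min[OF \<psi>'(1) this] have "AE \<omega> in M. f z \<omega> \<le> \<psi>' z \<omega>" using zw by (simp add: le_def)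
    moreover have "AE \<omega> in M. f (z \<oplus>\<^bsub>G\<^esub> w) \<omega> \<le> f z \<omega> + f w \<omega>"
      using f(1) zw by (simp add: dyadic_sublinear_def)
    ultimately show "AE \<omega> in M. f (z \<oplus>\<^bsub>G\<^esub> w) \<omega> = f z \<omega> + f w \<omega>"
      using \<psi>'(3)[OF zw(1)] by eventually_elim simp
  qed (use f in \<open>auto simp: dyadic_sublinear_def le_def\<close>)
qed

text \<open>A pair (w, t) encodes the constraint t u <= f w; the number t is kept since
  \<open>w\<close> need not determine it. All constraints are absorbed into the single sublinear
  function obtained as the infimum of q (z + w) - t u over \<open>N\<close>. Closure under sums and
  halves replaces the cone property, as only a group structure is at hand.\<close>

lemma (in finite_measure) additive_separation:
  assumes G: "abelian_group G" and q: "dyadic_sublinear M G q"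
    and u: "u \<in> borel_measurable M"
    and N: "N \<subseteq> carrier G \<times> (UNIV :: real set)" and N0: "(\<zero>\<^bsub>G\<^esub>, 0) \<in> N"
    and N_add: "\<And>w t v s. (w, t) \<in> N \<Longrightarrow> (v, s) \<in> N \<Longrightarrow> (w \<oplus>\<^bsub>G\<^esub> v, t + s) \<in> N"
    and N_half: "\<And>w t. (w, t) \<in> N \<Longrightarrow> \<exists>v. (v, t / 2) \<in> N \<and> v \<oplus>\<^bsub>G\<^esub> v = w"
    and N_q: "\<And>w t. (w, t) \<in> N \<Longrightarrow> AE \<omega> in M. t * u \<omega> \<le> q w \<omega>"
  obtains f where "\<And>z. z \<in> carrier G \<Longrightarrow> f z \<in> borel_measurable M"
    and "\<And>z w. z \<in> carrier G \<Longrightarrow> w \<in> carrier G \<Longrightarrow> AE \<omega> in M. f (z \<oplus>\<^bsub>G\<^esub> w) \<omega> = f z \<omega> + f w \<omega>"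
    and "\<And>z. z \<in> carrier G \<Longrightarrow> AE \<omega> in M. f z \<omega> \<le> q z \<omega>"
    and "\<And>w t. (w, t) \<in> N \<Longrightarrow> AE \<omega> in M. t * u \<omega> \<le> f w \<omega>"
proof -
  interpret G: abelian_group G by (rule G)
  define a where "a i z \<omega> = q (z \<oplus>\<^bsub>G\<^esub> fst i) \<omega> - snd i * u \<omega>" for i :: "'b \<times> real" and z \<omega>
  have Nc: "w \<in> carrier G" if "(w, t) \<in> N" for w t using that N by auto
  obtain \<phi> where \<phi>: "dyadic_sublinear M G \<phi>"
    and le: "\<And>i z. i \<in> N \<Longrightarrow> z \<in> carrier G \<Longrightarrow> AE \<omega> in M. \<phi> z \<omega> \<le> a i z \<omega>"
  proof (rule dyadic_sublinear_infimum[OF G, of N a "\<lambda>z \<omega>. - q (\<ominus>\<^bsub>G\<^esub> z) \<omega>"])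
    show "N \<noteq> {}" using N0 by blast
    fix i z assume i: "i \<in> N" and z: "z \<in> carrier G"
    obtain w t where wt: "i = (w, t)" by force
    have w: "w \<in> carrier G" using i wt Nc by blast
    have [measurable]: "q (z \<oplus>\<^bsub>G\<^esub> w) \<in> borel_measurable M" using q z w by (simp add: dyadic_sublinear_def)
    show "a i z \<in> borel_measurable M" unfolding a_def wt using u by simp
    show "AE \<omega> in M. - q (\<ominus>\<^bsub>G\<^esub> z) \<omega> \<le> a i z \<omega>"
      \<comment> \<open>q (z + w) >= q w - q (- z), and q w >= t u cancels the subtracted
        term.\<close>
      using dyadic_sublinear_diff[OF G q z w] N_q[OF i[unfolded wt]]
      by eventually_elim (simp add: a_def wt)
    obtain v where v: "(v, t / 2) \<in> N" "v \<oplus>\<^bsub>G\<^esub> v = w" using N_half i wt by blast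
    have eq: "(z \<oplus>\<^bsub>G\<^esub> v) \<oplus>\<^bsub>G\<^esub> (z \<oplus>\<^bsub>G\<^esub> v) = (z \<oplus>\<^bsub>G\<^esub> z) \<oplus>\<^bsub>G\<^esub> w"
      using z Nc[OF v(1)] by (simp add: G.add.m_ac flip: v(2))
    have "AE \<omega> in M. 2 * q (z \<oplus>\<^bsub>G\<^esub> v) \<omega> \<le> q ((z \<oplus>\<^bsub>G\<^esub> z) \<oplus>\<^bsub>G\<^esub> w) \<omega>"
      using q z Nc[OF v(1)] by (simp add: dyadic_sublinear_def flip: eq)
    then have "AE \<omega> in M. 2 * a (v, t / 2) z \<omega> \<le> a i (z \<oplus>\<^bsub>G\<^esub> z) \<omega>"
      by eventually_elim (simp add: a_def wt)
    with v show "\<exists>j\<in>N. AE \<omega> in M. 2 * a j z \<omega> \<le> a i (z \<oplus>\<^bsub>G\<^esub> z) \<omega>" by blast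
  next
    fix i j z y assume ij: "i \<in> N" "j \<in> N" and zy: "z \<in> carrier G" "y \<in> carrier G"
    obtain w t v s where wt: "i = (w, t)" "j = (v, s)" by force
    have wv: "w \<in> carrier G" "v \<in> carrier G" using ij wt Nc by blast+
    have eq: "(z \<oplus>\<^bsub>G\<^esub> w) \<oplus>\<^bsub>G\<^esub> (y \<oplus>\<^bsub>G\<^esub> v) = (z \<oplus>\<^bsub>G\<^esub> y) \<oplus>\<^bsub>G\<^esub> (w \<oplus>\<^bsub>G\<^esub> v)"
      using zy wv by (simp add: G.add.m_ac)
    have "AE \<omega> in M. q ((z \<oplus>\<^bsub>G\<^esub> y) \<oplus>\<^bsub>G\<^esub> (w \<oplus>\<^bsub>G\<^esub> v)) \<omega> \<le> q (z \<oplus>\<^bsub>G\<^esub> w) \<omega> + q (y \<oplus>\<^bsub>G\<^esub> v) \<omega>"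
      using q zy wv by (simp add: dyadic_sublinear_def flip: eq)
    then have "AE \<omega> in M. a (w \<oplus>\<^bsub>G\<^esub> v, t + s) (z \<oplus>\<^bsub>G\<^esub> y) \<omega> \<le> a i z \<omega> + a j y \<omega>"
      by eventually_elim (simp add: a_def wt algebra_simps)
    with N_add[of w t v s] ij wt
    show "\<exists>k\<in>N. AE \<omega> in M. a k (z \<oplus>\<^bsub>G\<^esub> y) \<omega> \<le> a i z \<omega> + a j y \<omega>" by blast
  qed blast
  obtain f where f: "\<And>z. z \<in> carrier G \<Longrightarrow> f z \<in> borel_measurable M"
    and f_add: "\<And>z w. z \<in> carrier G \<Longrightarrow> w \<in> carrier G \<Longrightarrow> AE \<omega> in M. f (z \<oplus>\<^bsub>G\<^esub> w) \<omega> = f z \<omega> + f w \<omega>"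
    and f_le: "\<And>z. z \<in> carrier G \<Longrightarrow> AE \<omega> in M. f z \<omega> \<le> \<phi> z \<omega>"
    using hahn_banach_L0[OF G \<phi>] by blast
  show thesis
  proof
    fix z assume z: "z \<in> carrier G"
    show "AE \<omega> in M. f z \<omega> \<le> q z \<omega>"
      using f_le[OF z] le[OF N0 z] by eventually_elim (simp add: a_def z)
  next
    fix w t assume wt: "(w, t) \<in> N"
    note w = Nc[OF wt]
    have "AE \<omega> in M. f \<zero>\<^bsub>G\<^esub> \<omega> = f \<zero>\<^bsub>G\<^esub> \<omega> + f \<zero>\<^bsub>G\<^esub> \<omega>"
      and "AE \<omega> in M. f \<zero>\<^bsub>G\<^esub> \<omega> = f w \<omega> + f (\<ominus>\<^bsub>G\<^esub> w) \<omega>"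
      using f_add[of "\<zero>\<^bsub>G\<^esub>" "\<zero>\<^bsub>G\<^esub>"] f_add[of w "\<ominus>\<^bsub>G\<^esub> w"] w by (simp_all add: G.r_neg)
    \<comment> \<open>At the point - w the index (w, t) leaves only q 0 - t u, and q 0 vanishes;
      additivity then changes the sign of f (- w).\<close>
    moreover have "AE \<omega> in M. f (\<ominus>\<^bsub>G\<^esub> w) \<omega> \<le> q \<zero>\<^bsub>G\<^esub> \<omega> - t * u \<omega>"
      using f_le[OF G.a_inv_closed[OF w]] le[OF wt G.a_inv_closed[OF w]]
      by eventually_elim (simp add: a_def G.l_neg w)
    ultimately show "AE \<omega> in M. t * u \<omega> \<le> f w \<omega>"
      using dyadic_sublinear_zero[OF G q] by eventually_elim simp
  qed (use f f_add in auto)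
qed


section \<open>Functionals on random locally convex modules\<close>

text \<open>Real scalars belong to \<open>L0_ring M K\<close> for either choice of \<open>K\<close>,
  so arguments with real multipliers are made once for both.\<close>

definition L0_of_real :: "'a measure \<Rightarrow> ('a \<Rightarrow> real) \<Rightarrow> ('a \<Rightarrow> complex) set" where
  "L0_of_real M g = rv_class M (\<lambda>\<omega>. complex_of_real (g \<omega>))"

text \<open>A sum instead of a maximum: it dominates each seminorm, is at most \<open>card Q\<close>
  times any common bound, and is 0 for empty \<open>Q\<close>, where the lattice supremum would be
  minus infinity.\<close>

definition sum_seminorm :: "('e \<Rightarrow> ('a \<Rightarrow> real) set) set \<Rightarrow> 'e \<Rightarrow> 'a \<Rightarrow> real" where
  "sum_seminorm Q z \<omega> = (\<Sum>p\<in>Q. rv_rep (p z) \<omega>)"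

lemma topspace_Tc:
  assumes P: "\<And>p. p \<in> P \<Longrightarrow> p \<in> carrier E \<rightarrow> L0_plus M"
    and add: "\<And>x y. x \<in> carrier E \<Longrightarrow> y \<in> carrier E \<Longrightarrow> x \<oplus>\<^bsub>E\<^esub> y \<in> carrier E"
  shows "topspace (Tc M E P) = carrier E"
proof -
  have "AE \<omega> in M. 0 < rv_rep (rv_class M (\<lambda>_. 1 :: real)) \<omega>"
    using rv_rep_class(2)[of "\<lambda>_. 1 :: real" M] by (auto elim: eventually_mono)
  then have "rv_class M (\<lambda>_. 1) \<in> L0_pplus M" by (simp add: L0_pplus_iff)
  then have "L0_open M E P (carrier E)"
    unfolding L0_open_def using add
    by (intro conjI subset_refl ballI exI[of _ "{}"] exI[of _ "rv_class M (\<lambda>_. 1)"])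
      (auto simp: L0_nbhd_def)
  moreover have "U \<subseteq> carrier E" if "L0_open M E P U" for U
    using that by (simp add: L0_open_def)
  moreover have "openin (Tc M E P) = L0_open M E P" by (rule openin_Tc) (rule P)
  ultimately show ?thesis unfolding topspace_def by auto
qed

lemma L0_plus_iff:
  "a \<in> L0_plus M \<longleftrightarrow> a \<in> L0 M \<and> (AE \<omega> in M. 0 \<le> rv_rep a \<omega>)"
proof -
  have "rv_on M (space M) (\<le>) (rv_class M (\<lambda>_. 0)) a \<longleftrightarrow> (AE \<omega> in M. 0 \<le> rv_rep a \<omega>)"
    if a: "a \<in> L0 M"
  proof -
    have "rv_on M (space M) (\<le>) (rv_class M (\<lambda>_. 0)) (rv_class M (rv_rep a)) \<longleftrightarrow>
        (AE \<omega> in M. \<omega> \<in> space M \<longrightarrow> 0 \<le> rv_rep a \<omega>)"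
      by (rule rv_on_class) (use L0_rep[OF a] in auto)
    also have "\<dots> \<longleftrightarrow> (AE \<omega> in M. 0 \<le> rv_rep a \<omega>)" by (rule AE_cong) simp
    finally show ?thesis using L0_rep[OF a] by simp
  qed
  then show ?thesis by (auto simp: L0_plus_def)
qed

context random_locally_convex_module
begin

section \<open>Arithmetic of real scalars acting on the module\<close>

lemma Reals_K: "complex_of_real r \<in> K"
  using K_cases by auto

lemma rv_class_carrier:
  "g \<in> borel_measurable M \<Longrightarrow> (\<And>\<omega>. \<omega> \<in> space M \<Longrightarrow> g \<omega> \<in> K) \<Longrightarrow>
    rv_class M g \<in> carrier (L0_ring M K)"
  by (auto simp: L0_ring_def)

lemma carrier_L0_ringE:
  assumes "\<xi> \<in> carrier (L0_ring M K)"
  obtains g where "g \<in> borel_measurable M" "\<And>\<omega>. \<omega> \<in> space M \<Longrightarrow> g \<omega> \<in> K" "\<xi> = rv_class M g"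
  using assms by (auto simp: L0_ring_def)

lemma L0_ring_ops:
  "g \<in> borel_measurable M \<Longrightarrow> h \<in> borel_measurable M \<Longrightarrow>
    rv_class M g \<oplus>\<^bsub>L0_ring M K\<^esub> rv_class M h = rv_class M (\<lambda>\<omega>. g \<omega> + h \<omega>)"
  "g \<in> borel_measurable M \<Longrightarrow> h \<in> borel_measurable M \<Longrightarrow>
    rv_class M g \<otimes>\<^bsub>L0_ring M K\<^esub> rv_class M h = rv_class M (\<lambda>\<omega>. g \<omega> * h \<omega>)"
  "\<one>\<^bsub>L0_ring M K\<^esub> = rv_class M (\<lambda>_. 1)" "\<zero>\<^bsub>L0_ring M K\<^esub> = rv_class M (\<lambda>_. 0)"
  by (simp_all add: L0_ring_def rv_map2_class)

lemma L0_of_real_carrier [simp]: "g \<in> borel_measurable M \<Longrightarrow> L0_of_real M g \<in> carrier (L0_ring M K)"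
  unfolding L0_of_real_def by (intro rv_class_carrier) (auto simp: Reals_K)

lemma L0_of_real_ops:
  assumes "g \<in> borel_measurable M" "h \<in> borel_measurable M"
  shows "L0_of_real M g \<oplus>\<^bsub>L0_ring M K\<^esub> L0_of_real M h = L0_of_real M (\<lambda>\<omega>. g \<omega> + h \<omega>)"
    and "L0_of_real M g \<otimes>\<^bsub>L0_ring M K\<^esub> L0_of_real M h = L0_of_real M (\<lambda>\<omega>. g \<omega> * h \<omega>)"
  using assms by (simp_all add: L0_of_real_def L0_ring_ops)

lemma L0_of_real_one: "\<one>\<^bsub>L0_ring M K\<^esub> = L0_of_real M (\<lambda>_. 1)" and L0_of_real_zero: "\<zero>\<^bsub>L0_ring M K\<^esub> = L0_of_real M (\<lambda>_. 0)"
  by (simp_all add: L0_of_real_def L0_ring_ops)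

lemma L0_of_real_minus:
  assumes g: "g \<in> borel_measurable M"
  shows "\<ominus>\<^bsub>L0_ring M K\<^esub> L0_of_real M g = L0_of_real M (\<lambda>\<omega>. - g \<omega>)"
proof (rule sym, rule R.sum_zero_eq_neg)
  show "L0_of_real M (\<lambda>\<omega>. - g \<omega>) \<oplus>\<^bsub>L0_ring M K\<^esub> L0_of_real M g = \<zero>\<^bsub>L0_ring M K\<^esub>"
    using g by (simp add: L0_of_real_ops L0_of_real_zero)
qed (use g in auto)

lemma L0_of_real_smult:
  assumes "g \<in> borel_measurable M" "h \<in> borel_measurable M" "z \<in> carrier E"
  shows "L0_of_real M g \<odot>\<^bsub>E\<^esub> (L0_of_real M h \<odot>\<^bsub>E\<^esub> z) = L0_of_real M (\<lambda>\<omega>. g \<omega> * h \<omega>) \<odot>\<^bsub>E\<^esub> z"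
    and "L0_of_real M g \<odot>\<^bsub>E\<^esub> z \<oplus>\<^bsub>E\<^esub> L0_of_real M h \<odot>\<^bsub>E\<^esub> z = L0_of_real M (\<lambda>\<omega>. g \<omega> + h \<omega>) \<odot>\<^bsub>E\<^esub> z"
  using assms by (simp_all add: smult_assoc1[symmetric] smult_l_distr[symmetric] L0_of_real_ops)

lemma L0_of_real_smult_one: "z \<in> carrier E \<Longrightarrow> L0_of_real M (\<lambda>_. 1) \<odot>\<^bsub>E\<^esub> z = z"
  using smult_one by (simp add: L0_of_real_one)

section \<open>The seminorm axioms as almost sure statements about representatives\<close>

lemma seminorm_maps: "p \<in> P \<Longrightarrow> p \<in> carrier E \<rightarrow> L0_plus M"
  using seminorm by (simp add: L0_seminorm_def)

lemma seminorm_rep: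
  assumes p: "p \<in> P" and z: "z \<in> carrier E"
  shows "p z \<in> L0 M" "rv_rep (p z) \<in> borel_measurable M" "AE \<omega> in M. 0 \<le> rv_rep (p z) \<omega>"
  using seminorm_maps[OF p] z L0_rep by (auto simp: L0_plus_iff Pi_iff)

lemma seminorm_rep_smult:
  assumes p: "p \<in> P" and z: "z \<in> carrier E"
    and g: "g \<in> borel_measurable M" "\<And>\<omega>. \<omega> \<in> space M \<Longrightarrow> g \<omega> \<in> K"
  shows "AE \<omega> in M. rv_rep (p (rv_class M g \<odot>\<^bsub>E\<^esub> z)) \<omega> = cmod (g \<omega>) * rv_rep (p z) \<omega>"
proof -
  note m = seminorm_rep(2)[OF p z]
  have "p (rv_class M g \<odot>\<^bsub>E\<^esub> z) = rv_map2 M (*) (rv_map M cmod (rv_class M g)) (p z)"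
    using seminorm[OF p] z rv_class_carrier[OF g] by (simp add: L0_seminorm_def)
  also have "\<dots> = rv_map2 M (*) (rv_class M (\<lambda>\<omega>. cmod (g \<omega>))) (rv_class M (rv_rep (p z)))"
    using g seminorm_rep(1)[OF p z] by (simp add: rv_map_class L0_rep)
  also have "\<dots> = rv_class M (\<lambda>\<omega>. cmod (g \<omega>) * rv_rep (p z) \<omega>)"
    using g m by (intro rv_map2_class) auto
  finally show ?thesis using g m by (auto intro!: rv_rep_class(2))
qed

lemma seminorm_rep_add:
  assumes p: "p \<in> P" and zw: "z \<in> carrier E" "w \<in> carrier E"
  shows "AE \<omega> in M. rv_rep (p (z \<oplus>\<^bsub>E\<^esub> w)) \<omega> \<le> rv_rep (p z) \<omega> + rv_rep (p w) \<omega>"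
proof -
  have "rv_on M (space M) (\<le>) (p (z \<oplus>\<^bsub>E\<^esub> w)) (rv_map2 M (+) (p z) (p w))"
    using seminorm[OF p] zw by (simp add: L0_seminorm_def)
  then have "AE \<omega> in M. \<omega> \<in> space M \<longrightarrow>
      rv_rep (p (z \<oplus>\<^bsub>E\<^esub> w)) \<omega> \<le> rv_rep (rv_map2 M (+) (p z) (p w)) \<omega>"
    by (simp add: rv_on_def)
  moreover have "AE \<omega> in M. rv_rep (rv_map2 M (+) (p z) (p w)) \<omega> = rv_rep (p z) \<omega> + rv_rep (p w) \<omega>"
    unfolding rv_map2_def using seminorm_rep(2)[OF p] zw by (intro rv_rep_class(2)) auto
  ultimately show ?thesis using AE_space by eventually_elim simp
qed

lemma sum_seminorm:
  assumes Q: "finite Q" "Q \<subseteq> P" and z: "z \<in> carrier E"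
  shows sum_seminorm_measurable: "sum_seminorm Q z \<in> borel_measurable M"
    and sum_seminorm_nonneg: "AE \<omega> in M. 0 \<le> sum_seminorm Q z \<omega>"
    and sum_seminorm_smult: "g \<in> borel_measurable M \<Longrightarrow> (\<And>\<omega>. \<omega> \<in> space M \<Longrightarrow> g \<omega> \<in> K) \<Longrightarrow>
      AE \<omega> in M. sum_seminorm Q (rv_class M g \<odot>\<^bsub>E\<^esub> z) \<omega> = cmod (g \<omega>) * sum_seminorm Q z \<omega>"
    and sum_seminorm_add: "w \<in> carrier E \<Longrightarrow>
      AE \<omega> in M. sum_seminorm Q (z \<oplus>\<^bsub>E\<^esub> w) \<omega> \<le> sum_seminorm Q z \<omega> + sum_seminorm Q w \<omega>"
proof -
  have QP: "p \<in> P" if "p \<in> Q" for p using that Q by blast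
  show "sum_seminorm Q z \<in> borel_measurable M"
    unfolding sum_seminorm_def[abs_def] using seminorm_rep(2)[OF QP z] by (intro borel_measurable_sum)
  have "AE \<omega> in M. \<forall>p\<in>Q. 0 \<le> rv_rep (p z) \<omega>"
    using seminorm_rep(3)[OF QP z] Q by (intro AE_finite_allI) auto
  then show "AE \<omega> in M. 0 \<le> sum_seminorm Q z \<omega>"
    by eventually_elim (simp add: sum_seminorm_def sum_nonneg)
  show "AE \<omega> in M. sum_seminorm Q (rv_class M g \<odot>\<^bsub>E\<^esub> z) \<omega> = cmod (g \<omega>) * sum_seminorm Q z \<omega>"
    if g: "g \<in> borel_measurable M" "\<And>\<omega>. \<omega> \<in> space M \<Longrightarrow> g \<omega> \<in> K"
  proof -
    have "AE \<omega> in M. \<forall>p\<in>Q. rv_rep (p (rv_class M g \<odot>\<^bsub>E\<^esub> z)) \<omega> = cmod (g \<omega>) * rv_rep (p z) \<omega>"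
      using seminorm_rep_smult[OF QP z g] Q by (intro AE_finite_allI) auto
    then show ?thesis by eventually_elim (simp add: sum_seminorm_def sum_distrib_left)
  qed
  show "AE \<omega> in M. sum_seminorm Q (z \<oplus>\<^bsub>E\<^esub> w) \<omega> \<le> sum_seminorm Q z \<omega> + sum_seminorm Q w \<omega>"
    if w: "w \<in> carrier E"
  proof -
    have "AE \<omega> in M. \<forall>p\<in>Q. rv_rep (p (z \<oplus>\<^bsub>E\<^esub> w)) \<omega> \<le> rv_rep (p z) \<omega> + rv_rep (p w) \<omega>"
      using seminorm_rep_add[OF QP z w] Q by (intro AE_finite_allI) auto
    then show ?thesis
      by eventually_elim (simp add: sum_seminorm_def sum_mono flip: sum.distrib)
  qed
qed

lemma sum_seminorm_L0_of_real:
  assumes "finite Q" "Q \<subseteq> P" "z \<in> carrier E" and g: "g \<in> borel_measurable M"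
  shows "AE \<omega> in M. sum_seminorm Q (L0_of_real M g \<odot>\<^bsub>E\<^esub> z) \<omega> = \<bar>g \<omega>\<bar> * sum_seminorm Q z \<omega>"
  using sum_seminorm_smult[OF assms(1-3), of "\<lambda>\<omega>. complex_of_real (g \<omega>)"] g
  by (simp add: L0_of_real_def Reals_K)

lemma L0_nbhd_iff:
  assumes "finite Q" "Q \<subseteq> P" "\<epsilon> \<in> L0 M"
  shows "z \<in> L0_nbhd M E Q \<epsilon> \<longleftrightarrow>
    z \<in> carrier E \<and> (AE \<omega> in M. \<forall>p\<in>Q. rv_rep (p z) \<omega> \<le> rv_rep \<epsilon> \<omega>)"
proof -
  have "p z \<in> L0 M" if "p \<in> Q" "z \<in> carrier E" for p
    using that assms seminorm_rep(1) by blast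
  then show ?thesis
    using Sup_seminorm_finite(3)[of Q z M \<epsilon>] assms by (auto simp: L0_nbhd_def)
qed

lemma dyadic_sublinear_sum_seminorm:
  assumes Q: "finite Q" "Q \<subseteq> P"
  shows "dyadic_sublinear M E (sum_seminorm Q)"
  unfolding dyadic_sublinear_def
proof (intro conjI ballI)
  fix z assume z: "z \<in> carrier E"
  have "z \<oplus>\<^bsub>E\<^esub> z = L0_of_real M (\<lambda>_. 2) \<odot>\<^bsub>E\<^esub> z"
    using L0_of_real_smult(2)[of "\<lambda>_. 1" "\<lambda>_. 1" z] z by (simp add: L0_of_real_smult_one)
  then show "AE \<omega> in M. 2 * sum_seminorm Q z \<omega> \<le> sum_seminorm Q (z \<oplus>\<^bsub>E\<^esub> z) \<omega>"
    using sum_seminorm_L0_of_real[OF Q z, of "\<lambda>_. 2"] by (auto elim: eventually_mono)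
qed (use sum_seminorm[OF Q] in auto)

section \<open>From additive dominated maps to continuous linear ones\<close>

text \<open>The bound \<open>\<bar>g \<omega>\<bar> * q z \<omega>\<close> on the value at g z makes
  \<open>f\<close> local: multipliers that agree on an event give the same value there. Additivity
  handles constant integers, locality extends this to integer-valued random variables, and
  approximation reaches all measurable multipliers.\<close>

lemma additive_dominated_linear:
  assumes f: "\<And>z. z \<in> carrier E \<Longrightarrow> f z \<in> borel_measurable M"
    and add: "\<And>z w. z \<in> carrier E \<Longrightarrow> w \<in> carrier E \<Longrightarrow>
      AE \<omega> in M. f (z \<oplus>\<^bsub>E\<^esub> w) \<omega> = f z \<omega> + f w \<omega>"
    and dom: "\<And>z. z \<in> carrier E \<Longrightarrow> AE \<omega> in M. f z \<omega> \<le> q z \<omega>"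
    and q: "\<And>g z. g \<in> borel_measurable M \<Longrightarrow> z \<in> carrier E \<Longrightarrow>
      AE \<omega> in M. q (L0_of_real M g \<odot>\<^bsub>E\<^esub> z) \<omega> = \<bar>g \<omega>\<bar> * q z \<omega>"
  shows additive_dominated_abs: "z \<in> carrier E \<Longrightarrow> AE \<omega> in M. \<bar>f z \<omega>\<bar> \<le> q z \<omega>"
    and additive_dominated_L0_of_real: "z \<in> carrier E \<Longrightarrow> g \<in> borel_measurable M \<Longrightarrow>
      AE \<omega> in M. f (L0_of_real M g \<odot>\<^bsub>E\<^esub> z) \<omega> = g \<omega> * f z \<omega>"
proof -
  have add_L0_of_real: "AE \<omega> in M. f (L0_of_real M (\<lambda>\<omega>. g \<omega> + h \<omega>) \<odot>\<^bsub>E\<^esub> z) \<omega> =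
      f (L0_of_real M g \<odot>\<^bsub>E\<^esub> z) \<omega> + f (L0_of_real M h \<odot>\<^bsub>E\<^esub> z) \<omega>"
    if z: "z \<in> carrier E" and g: "g \<in> borel_measurable M" and h: "h \<in> borel_measurable M" for z g h
    using add[of "L0_of_real M g \<odot>\<^bsub>E\<^esub> z" "L0_of_real M h \<odot>\<^bsub>E\<^esub> z"] z g h by (simp add: L0_of_real_smult)
  have zero: "AE \<omega> in M. f (L0_of_real M (\<lambda>_. 0) \<odot>\<^bsub>E\<^esub> z) \<omega> = 0" if z: "z \<in> carrier E" for z
    using add_L0_of_real[OF z, of "\<lambda>_. 0" "\<lambda>_. 0"] by simp
  have abs: "AE \<omega> in M. \<bar>f z \<omega>\<bar> \<le> q z \<omega>" if z: "z \<in> carrier E" for z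
  proof -
    have "AE \<omega> in M. f (L0_of_real M (\<lambda>_. 0) \<odot>\<^bsub>E\<^esub> z) \<omega> = f z \<omega> + f (L0_of_real M (\<lambda>_. - 1) \<odot>\<^bsub>E\<^esub> z) \<omega>"
      using add_L0_of_real[OF z, of "\<lambda>_. 1" "\<lambda>_. - 1"] z by (simp add: L0_of_real_smult_one)
    moreover have "AE \<omega> in M. f (L0_of_real M (\<lambda>_. - 1) \<odot>\<^bsub>E\<^esub> z) \<omega> \<le> q (L0_of_real M (\<lambda>_. - 1) \<odot>\<^bsub>E\<^esub> z) \<omega>"
      by (rule dom) (simp add: z)
    moreover have "AE \<omega> in M. q (L0_of_real M (\<lambda>_. - 1) \<odot>\<^bsub>E\<^esub> z) \<omega> = q z \<omega>"
      using q[of "\<lambda>_. - 1" z] z by simp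
    ultimately show ?thesis using zero[OF z] dom[OF z] by eventually_elim linarith
  qed
  have abs_L0_of_real: "AE \<omega> in M. \<bar>f (L0_of_real M g \<odot>\<^bsub>E\<^esub> z) \<omega>\<bar> \<le> \<bar>g \<omega>\<bar> * q z \<omega>"
    if "z \<in> carrier E" "g \<in> borel_measurable M" for z g
  proof -
    have "AE \<omega> in M. \<bar>f (L0_of_real M g \<odot>\<^bsub>E\<^esub> z) \<omega>\<bar> \<le> q (L0_of_real M g \<odot>\<^bsub>E\<^esub> z) \<omega>"
      by (rule abs) (simp add: that)
    with q[OF that(2,1)] show ?thesis by eventually_elim simp
  qed
  have int: "AE \<omega> in M. f (L0_of_real M (\<lambda>_. of_int k) \<odot>\<^bsub>E\<^esub> z) \<omega> = of_int k * f z \<omega>"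
    if z: "z \<in> carrier E" for z k
  proof (induction k rule: int_induct[where k = 0])
    case base
    show ?case using zero[OF z] by simp
  next
    case (step1 k)
    have "AE \<omega> in M. f (L0_of_real M (\<lambda>_. of_int (k + 1)) \<odot>\<^bsub>E\<^esub> z) \<omega> =
        f (L0_of_real M (\<lambda>_. of_int k) \<odot>\<^bsub>E\<^esub> z) \<omega> + f z \<omega>"
      using add_L0_of_real[OF z, of "\<lambda>_. of_int k" "\<lambda>_. 1"] z by (simp add: L0_of_real_smult_one)
    with step1(2) show ?case by eventually_elim (simp add: algebra_simps)
  next
    case (step2 k)
    have "AE \<omega> in M. f (L0_of_real M (\<lambda>_. of_int k) \<odot>\<^bsub>E\<^esub> z) \<omega> =
        f (L0_of_real M (\<lambda>_. of_int (k - 1)) \<odot>\<^bsub>E\<^esub> z) \<omega> + f z \<omega>"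
      using add_L0_of_real[OF z, of "\<lambda>_. of_int (k - 1)" "\<lambda>_. 1"] z by (simp add: L0_of_real_smult_one)
    with step2(2) show ?case by eventually_elim (simp add: algebra_simps)
  qed
  have local_zero: "AE \<omega> in M. h \<omega> = 0 \<longrightarrow> f (L0_of_real M h \<odot>\<^bsub>E\<^esub> z) \<omega> = 0"
    if "z \<in> carrier E" "h \<in> borel_measurable M" for z h
    using abs_L0_of_real[OF that] by eventually_elim auto
  have local: "AE \<omega> in M. g \<omega> = h \<omega> \<longrightarrow> f (L0_of_real M g \<odot>\<^bsub>E\<^esub> z) \<omega> = f (L0_of_real M h \<odot>\<^bsub>E\<^esub> z) \<omega>"
    if z: "z \<in> carrier E" and g: "g \<in> borel_measurable M" and h: "h \<in> borel_measurable M" for z g h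
  proof -
    have m: "(\<lambda>\<omega>. g \<omega> - h \<omega>) \<in> borel_measurable M" using g h by measurable
    from add_L0_of_real[OF z h m] local_zero[OF z m] show ?thesis by eventually_elim auto
  qed
  \<comment> \<open>On each of the countably many events where the floor equals k, locality replaces
    the random multiplier by the constant k.\<close>
  have floor: "AE \<omega> in M. f (L0_of_real M (\<lambda>\<omega>. of_int \<lfloor>g \<omega>\<rfloor>) \<odot>\<^bsub>E\<^esub> z) \<omega> = of_int \<lfloor>g \<omega>\<rfloor> * f z \<omega>"
    if z: "z \<in> carrier E" and g: "g \<in> borel_measurable M" for z and g :: "'a \<Rightarrow> real"
  proof -
    have m: "(\<lambda>\<omega>. of_int \<lfloor>g \<omega>\<rfloor> :: real) \<in> borel_measurable M" using g by measurable
    have "AE \<omega> in M. \<forall>k. of_int \<lfloor>g \<omega>\<rfloor> = (of_int k :: real) \<longrightarrow>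
        f (L0_of_real M (\<lambda>\<omega>. of_int \<lfloor>g \<omega>\<rfloor>) \<odot>\<^bsub>E\<^esub> z) \<omega> = f (L0_of_real M (\<lambda>_. of_int k) \<odot>\<^bsub>E\<^esub> z) \<omega>"
      unfolding AE_all_countable using local[OF z m, of "\<lambda>_. of_int k" for k] by simp
    moreover have "AE \<omega> in M. \<forall>k. f (L0_of_real M (\<lambda>_. of_int k) \<odot>\<^bsub>E\<^esub> z) \<omega> = of_int k * f z \<omega>"
      unfolding AE_all_countable using int[OF z] by blast
    ultimately show ?thesis by eventually_elim simp
  qed
  show "AE \<omega> in M. \<bar>f z \<omega>\<bar> \<le> q z \<omega>" if "z \<in> carrier E" using that by (rule abs)
  show "AE \<omega> in M. f (L0_of_real M g \<odot>\<^bsub>E\<^esub> z) \<omega> = g \<omega> * f z \<omega>"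
    if z: "z \<in> carrier E" and g: "g \<in> borel_measurable M"
  proof -
    let ?gz = "L0_of_real M g \<odot>\<^bsub>E\<^esub> z"
    \<comment> \<open>Compare \<open>n g\<close> with its floor, on whose countably many level sets \<open>f\<close> is known; then divide by \<open>n\<close>.\<close>
    have "AE \<omega> in M. \<bar>real n * (f ?gz \<omega> - g \<omega> * f z \<omega>)\<bar> \<le> 2 * q z \<omega>" for n
    proof -
      let ?n = "\<lambda>\<omega>. real n * g \<omega>"
      have n: "?n \<in> borel_measurable M" using g by measurable
      have fl: "(\<lambda>\<omega>. of_int \<lfloor>?n \<omega>\<rfloor> :: real) \<in> borel_measurable M" using n by measurable
      have fr: "(\<lambda>\<omega>. frac (?n \<omega>)) \<in> borel_measurable M" unfolding frac_def using n fl by measurable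
      have "AE \<omega> in M. f (L0_of_real M ?n \<odot>\<^bsub>E\<^esub> z) \<omega> = real n * f ?gz \<omega>"
        using int[of ?gz "int n"] z g by (simp add: L0_of_real_smult)
      moreover have "AE \<omega> in M. f (L0_of_real M ?n \<odot>\<^bsub>E\<^esub> z) \<omega> =
          f (L0_of_real M (\<lambda>\<omega>. of_int \<lfloor>?n \<omega>\<rfloor>) \<odot>\<^bsub>E\<^esub> z) \<omega> + f (L0_of_real M (\<lambda>\<omega>. frac (?n \<omega>)) \<odot>\<^bsub>E\<^esub> z) \<omega>"
        using add_L0_of_real[OF z fl fr] by (simp add: frac_def)
      ultimately show ?thesis using floor[OF z n] abs_L0_of_real[OF z fr] abs[OF z]
      proof eventually_elim
        case (elim \<omega>)
        let ?r = "frac (?n \<omega>)"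
        have r: "\<bar>?r\<bar> \<le> 1" using frac_lt_1[of "?n \<omega>"] frac_ge_0[of "?n \<omega>"] by linarith
        have q0: "0 \<le> q z \<omega>" using elim(5) by linarith
        have fl_eq: "of_int \<lfloor>?n \<omega>\<rfloor> = ?n \<omega> - ?r" by (simp add: frac_def)
        \<comment> \<open>The integer parts cancel. Two error terms remain, each at most
          \<open>q z \<omega>\<close> because the fractional part lies in [0, 1); this is the
          constant 2.\<close>
        have "real n * (f ?gz \<omega> - g \<omega> * f z \<omega>) =
            f (L0_of_real M (\<lambda>\<omega>. frac (?n \<omega>)) \<odot>\<^bsub>E\<^esub> z) \<omega> - ?r * f z \<omega>"
          using elim(1,2,3) unfolding fl_eq by (simp add: algebra_simps)
        moreover have "\<bar>?r\<bar> * q z \<omega> \<le> q z \<omega>" using mult_right_mono[OF r q0] by simp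
        moreover have "\<bar>?r * f z \<omega>\<bar> \<le> q z \<omega>"
          using mult_mono[OF r elim(5)] by (simp add: abs_mult)
        ultimately show ?case using elim(4) by linarith
      qed
    qed
    then have "AE \<omega> in M. \<forall>n. \<bar>real n * (f ?gz \<omega> - g \<omega> * f z \<omega>)\<bar> \<le> 2 * q z \<omega>"
      unfolding AE_all_countable by blast
    then show ?thesis
    proof eventually_elim
      case (elim \<omega>)
      show ?case
      proof (rule ccontr)
        assume "\<not> ?thesis"
        then have "0 < \<bar>f ?gz \<omega> - g \<omega> * f z \<omega>\<bar>" by simp
        from ex_less_of_nat_mult[OF this, of "2 * q z \<omega>"] obtain n
          where "2 * q z \<omega> < real n * \<bar>f ?gz \<omega> - g \<omega> * f z \<omega>\<bar>" by blast
        with elim[rule_format, of n] show False by (simp add: abs_mult)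
      qed
    qed
  qed
qed

text \<open>By additivity only neighbourhoods of zero matter, and there domination by finitely many
  seminorms of \<open>P\<close> turns a bound on each of them into a bound on
  \<open>F\<close>.\<close>

lemma dominated_functional_continuous:
  assumes Q: "finite Q" "Q \<subseteq> P" and F: "F \<in> carrier E \<rightarrow> carrier (L0_ring M K)"
    and add: "\<And>z w. z \<in> carrier E \<Longrightarrow> w \<in> carrier E \<Longrightarrow> F (z \<oplus>\<^bsub>E\<^esub> w) = F z \<oplus>\<^bsub>L0_ring M K\<^esub> F w"
    and dom: "\<And>z. z \<in> carrier E \<Longrightarrow> AE \<omega> in M. cmod (rv_rep (F z) \<omega>) \<le> c * sum_seminorm Q z \<omega>"
    and c: "0 < c"
  shows "continuous_map (Tc M E P) (Tc M (L0_ring M K) {rv_map M cmod}) F"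
proof -
  have cm: "rv_map M cmod \<xi> \<in> L0 M" "AE \<omega> in M. rv_rep (rv_map M cmod \<xi>) \<omega> = cmod (rv_rep \<xi> \<omega>)"
    if \<xi>: "\<xi> \<in> carrier (L0_ring M K)" for \<xi>
  proof -
    have "\<xi> \<in> L0 M" using \<xi> by (auto elim: carrier_L0_ringE)
    then have m: "(\<lambda>\<omega>. cmod (rv_rep \<xi> \<omega>)) \<in> borel_measurable M" using L0_rep(1) by measurable
    show "rv_map M cmod \<xi> \<in> L0 M" unfolding rv_map_def using m by simp
    show "AE \<omega> in M. rv_rep (rv_map M cmod \<xi>) \<omega> = cmod (rv_rep \<xi> \<omega>)"
      unfolding rv_map_def using m by (rule rv_rep_class(2))
  qed
  have "AE \<omega> in M. 0 \<le> rv_rep (rv_map M cmod \<xi>) \<omega>" if "\<xi> \<in> carrier (L0_ring M K)" for \<xi>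
    using cm(2)[OF that] by eventually_elim simp
  with cm(1) have cmP: "p \<in> carrier (L0_ring M K) \<rightarrow> L0_plus M" if "p \<in> {rv_map M cmod}" for p
    using that by (auto simp: L0_plus_iff)
  let ?R = "L0_ring M K"
  have E_top: "openin (Tc M E P) = L0_open M E P" "topspace (Tc M E P) = carrier E"
    by (rule openin_Tc topspace_Tc; simp add: seminorm_maps)+
  have R_top: "openin (Tc M ?R {rv_map M cmod}) = L0_open M ?R {rv_map M cmod}"
    "topspace (Tc M ?R {rv_map M cmod}) = carrier ?R"
    by (rule openin_Tc topspace_Tc; simp add: cmP)+
  show ?thesis
    unfolding continuous_map_def E_top R_top
  proof (intro conjI allI impI)
    fix V assume V: "L0_open M (L0_ring M K) {rv_map M cmod} V"
    show "L0_open M E P {x \<in> carrier E. F x \<in> V}"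
      unfolding L0_open_def
    proof (intro conjI ballI)
      fix z assume "z \<in> {x \<in> carrier E. F x \<in> V}"
      then have z: "z \<in> carrier E" and "F z \<in> V" by auto
      then obtain Q' \<epsilon> where Q': "finite Q'" "Q' \<subseteq> {rv_map M cmod}" and \<epsilon>: "\<epsilon> \<in> L0_pplus M"
        and sub: "(\<lambda>y. F z \<oplus>\<^bsub>L0_ring M K\<^esub> y) ` L0_nbhd M (L0_ring M K) Q' \<epsilon> \<subseteq> V"
        using V unfolding L0_open_def by meson
      have e: "\<epsilon> \<in> L0 M" "AE \<omega> in M. 0 < rv_rep \<epsilon> \<omega>" using \<epsilon> by (auto simp: L0_pplus_iff)
      \<comment> \<open>The added 1 keeps the divisor positive when \<open>Q\<close> is
        empty.\<close>
      let ?N = "c * (real (card Q) + 1)"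
      have N: "0 < ?N" using c by (simp add: add_nonneg_pos)
      define \<delta> where "\<delta> = rv_class M (\<lambda>\<omega>. rv_rep \<epsilon> \<omega> / ?N)"
      have m: "(\<lambda>\<omega>. rv_rep \<epsilon> \<omega> / ?N) \<in> borel_measurable M" using L0_rep(1)[OF e(1)] by measurable
      have d: "\<delta> \<in> L0 M" "AE \<omega> in M. rv_rep \<delta> \<omega> = rv_rep \<epsilon> \<omega> / ?N"
        unfolding \<delta>_def using m rv_rep_class(2)[OF m] by auto
      have "AE \<omega> in M. 0 < rv_rep \<delta> \<omega>" using d(2) e(2) by eventually_elim (use N in simp)
      then have \<delta>: "\<delta> \<in> L0_pplus M" using d(1) by (simp add: L0_pplus_iff)
      have "z \<oplus>\<^bsub>E\<^esub> y \<in> {x \<in> carrier E. F x \<in> V}" if y: "y \<in> L0_nbhd M E Q \<delta>" for y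
      proof -
        have yc: "y \<in> carrier E" and le: "AE \<omega> in M. \<forall>p\<in>Q. rv_rep (p y) \<omega> \<le> rv_rep \<delta> \<omega>"
          using y L0_nbhd_iff[OF Q d(1)] by auto
        have Fy: "F y \<in> carrier (L0_ring M K)" using F yc by auto
        have "AE \<omega> in M. cmod (rv_rep (F y) \<omega>) \<le> rv_rep \<epsilon> \<omega>"
          using le d(2) e(2) dom[OF yc]
        proof eventually_elim
          case (elim \<omega>)
          have "sum_seminorm Q y \<omega> \<le> real (card Q) * rv_rep \<delta> \<omega>"
            unfolding sum_seminorm_def using sum_bounded_above[of Q "\<lambda>p. rv_rep (p y) \<omega>"] elim(1) by simp
          also have "\<dots> \<le> (real (card Q) + 1) * rv_rep \<delta> \<omega>"
            using elim(2,3) N by (intro mult_right_mono) auto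
          finally have "c * sum_seminorm Q y \<omega> \<le> c * ((real (card Q) + 1) * rv_rep \<delta> \<omega>)"
            using c by (simp add: mult_left_mono)
          also have "\<dots> = rv_rep \<epsilon> \<omega>" using N elim(2) by (simp add: field_simps)
          finally show ?case using elim(4) by linarith
        qed
        with cm(2)[OF Fy] have "AE \<omega> in M. rv_rep (rv_map M cmod (F y)) \<omega> \<le> rv_rep \<epsilon> \<omega>"
          by eventually_elim simp
        then have "AE \<omega> in M. \<forall>p\<in>Q'. rv_rep (p (F y)) \<omega> \<le> rv_rep \<epsilon> \<omega>"
          using Q'(2) by (auto elim!: eventually_mono)
        then have "F y \<in> L0_nbhd M (L0_ring M K) Q' \<epsilon>"
          using Sup_seminorm_finite(3)[OF Q'(1), of "F y" M \<epsilon>] Q'(2) cm(1)[OF Fy] e(1) Fy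
          by (auto simp: L0_nbhd_def)
        then have "F z \<oplus>\<^bsub>L0_ring M K\<^esub> F y \<in> V" using sub by blast
        then show ?thesis using add z yc by simp
      qed
      with Q \<delta> show "\<exists>Q \<epsilon>. finite Q \<and> Q \<subseteq> P \<and> \<epsilon> \<in> L0_pplus M \<and>
          (\<lambda>y. z \<oplus>\<^bsub>E\<^esub> y) ` L0_nbhd M E Q \<epsilon> \<subseteq> {x \<in> carrier E. F x \<in> V}"
        by blast
    qed auto
  qed (use F in auto)
qed


subsection \<open>Separation\<close>

lemma L0_of_real_smult_minus: "z \<in> carrier E \<Longrightarrow> L0_of_real M (\<lambda>_. - 1) \<odot>\<^bsub>E\<^esub> z = \<ominus>\<^bsub>E\<^esub> z"
  using smult_l_minus[of "\<one>\<^bsub>L0_ring M K\<^esub>" z] by (simp add: L0_of_real_one L0_of_real_minus L0_of_real_smult_one)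

text \<open>By homogeneity I_A q (z - x) = q (I_A (z - x)), which depends on \<open>z\<close> only
  through I_A z. This makes concatenation compatible with the seminorms.\<close>

lemma sum_seminorm_indicator_cong:
  assumes Q: "finite Q" "Q \<subseteq> P" and A: "A \<in> sets M"
    and zw: "z \<in> carrier E" "w \<in> carrier E" and x: "x \<in> carrier E"
    and eq: "L0_indicator M A \<odot>\<^bsub>E\<^esub> z = L0_indicator M A \<odot>\<^bsub>E\<^esub> w"
  shows "AE \<omega> in M. \<omega> \<in> A \<longrightarrow> sum_seminorm Q (z \<ominus>\<^bsub>E\<^esub> x) \<omega> = sum_seminorm Q (w \<ominus>\<^bsub>E\<^esub> x) \<omega>"
proof -
  have ind: "L0_indicator M A = L0_of_real M (indicator A)"
    unfolding L0_indicator_def L0_of_real_def by (rule rv_class_cong) (auto simp: indicator_def)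
  have m: "(indicator A :: 'a \<Rightarrow> real) \<in> borel_measurable M" using A by simp
  have eq': "L0_of_real M (indicator A) \<odot>\<^bsub>E\<^esub> (z \<ominus>\<^bsub>E\<^esub> x) = L0_of_real M (indicator A) \<odot>\<^bsub>E\<^esub> (w \<ominus>\<^bsub>E\<^esub> x)"
    using eq zw x m by (simp add: ind a_minus_def smult_r_distr)
  have "AE \<omega> in M. sum_seminorm Q (L0_of_real M (indicator A) \<odot>\<^bsub>E\<^esub> (z \<ominus>\<^bsub>E\<^esub> x)) \<omega> =
      \<bar>indicator A \<omega>\<bar> * sum_seminorm Q (z \<ominus>\<^bsub>E\<^esub> x) \<omega>"
    "AE \<omega> in M. sum_seminorm Q (L0_of_real M (indicator A) \<odot>\<^bsub>E\<^esub> (z \<ominus>\<^bsub>E\<^esub> x)) \<omega> =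
      \<bar>indicator A \<omega>\<bar> * sum_seminorm Q (w \<ominus>\<^bsub>E\<^esub> x) \<omega>"
    using sum_seminorm_L0_of_real[OF Q _ m, of "z \<ominus>\<^bsub>E\<^esub> x"] sum_seminorm_L0_of_real[OF Q _ m, of "w \<ominus>\<^bsub>E\<^esub> x"] zw x
    by (simp_all add: eq')
  then show ?thesis by eventually_elim auto
qed

text \<open>The events \<open>A y\<close>, where y is closer to \<open>x\<close> than the threshold,
  are exhausted by countably many of them, and \<open>B\<close> is what they leave over. Were
  \<open>B\<close> null, pasting the corresponding points would give a member of \<open>C\<close>
  close to \<open>x\<close> almost everywhere, against closedness.\<close>

lemma distance_positive_on:
  assumes x: "x \<in> carrier E" and C: "C \<subseteq> carrier E" "C \<noteq> {}"
    and closed: "closedin (Tc M E P) C" and conc: "countable_concatenation M E C" and "x \<notin> C"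
  obtains Q \<epsilon> B where "finite Q" "Q \<subseteq> P" "\<epsilon> \<in> borel_measurable M" "\<And>\<omega>. 0 < \<epsilon> \<omega>"
    "B \<in> sets M" "measure M B > 0"
    "\<And>y. y \<in> C \<Longrightarrow> AE \<omega> in M. \<omega> \<in> B \<longrightarrow> \<epsilon> \<omega> \<le> sum_seminorm Q (y \<ominus>\<^bsub>E\<^esub> x) \<omega>"
proof -
  have E_top: "openin (Tc M E P) = L0_open M E P" "topspace (Tc M E P) = carrier E"
    by (rule openin_Tc topspace_Tc; simp add: seminorm_maps)+
  have "L0_open M E P (carrier E - C)" using closed by (simp add: closedin_def E_top)
  then obtain Q e where Q: "finite Q" "Q \<subseteq> P" and e: "e \<in> L0_pplus M"
    and sub: "(\<lambda>y. x \<oplus>\<^bsub>E\<^esub> y) ` L0_nbhd M E Q e \<subseteq> carrier E - C"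
    using x \<open>x \<notin> C\<close> unfolding L0_open_def by (meson DiffI)
  have e': "e \<in> L0 M" "AE \<omega> in M. 0 < rv_rep e \<omega>" using e by (auto simp: L0_pplus_iff)
  \<comment> \<open>The representative may fail to be positive on a null set; the value 1 there
    makes the threshold positive at every point.\<close>
  define \<epsilon> where "\<epsilon> \<omega> = (if 0 < rv_rep e \<omega> then rv_rep e \<omega> else 1)" for \<omega>
  have \<epsilon>: "\<epsilon> \<in> borel_measurable M" unfolding \<epsilon>_def using L0_rep(1)[OF e'(1)] by measurable
  have \<epsilon>0: "0 < \<epsilon> \<omega>" for \<omega> by (simp add: \<epsilon>_def)
  have \<epsilon>e: "AE \<omega> in M. \<epsilon> \<omega> = rv_rep e \<omega>" using e'(2) by eventually_elim (simp add: \<epsilon>_def)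
  have qm: "sum_seminorm Q (y \<ominus>\<^bsub>E\<^esub> x) \<in> borel_measurable M" if "y \<in> carrier E" for y
    using sum_seminorm_measurable[OF Q] that x by simp
  define A where "A y = {\<omega> \<in> space M. sum_seminorm Q (y \<ominus>\<^bsub>E\<^esub> x) \<omega> < \<epsilon> \<omega>}" for y
  have A: "A y \<in> sets M" if "y \<in> C" for y
  proof -
    have "y \<in> carrier E" using that C by blast
    from qm[OF this] \<epsilon> show ?thesis unfolding A_def by measurable
  qed
  obtain s :: "nat \<Rightarrow> 'e" where s: "range s \<subseteq> C"
    and ub: "\<And>y. y \<in> C \<Longrightarrow> AE \<omega> in M. \<omega> \<in> A y \<longrightarrow> \<omega> \<in> (\<Union>n. A (s n))"
    using essential_union[of C A, OF A C(2)] by blast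
  have sC: "s n \<in> C" for n using s by blast
  have sE: "s n \<in> carrier E" for n using sC C by blast
  define B where "B = space M - (\<Union>n. A (s n))"
  have B: "B \<in> sets M" unfolding B_def using A[OF sC] by auto
  have "measure M B \<noteq> 0"
  proof
    assume "measure M B = 0"
    then have "B \<in> null_sets M" using B by (intro null_setsI) (simp_all add: emeasure_eq_measure)
    from AE_not_in[OF this] have notB: "AE \<omega> in M. \<omega> \<notin> B" .
    \<comment> \<open>Concatenation asks for an exact partition of the space, so the null set
      \<open>B\<close> is added to the first event before the events are made disjoint.\<close>
    define A' where "A' n = (if n = 0 then A (s 0) \<union> B else A (s n))" for n
    define D where "D = disjointed A'"
    have A'A: "A' n \<subseteq> A (s n) \<union> B" "A (s n) \<subseteq> A' n" for n by (auto simp: A'_def)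
    have A': "A' n \<in> sets M" for n using A[OF sC] B by (simp add: A'_def)
    have "(\<Union>n. A' n) = space M"
    proof
      show "(\<Union>n. A' n) \<subseteq> space M" using sets.sets_into_space[OF A'] by blast
      show "space M \<subseteq> (\<Union>n. A' n)"
      proof
        fix \<omega> assume "\<omega> \<in> space M"
        then have "\<omega> \<in> B \<or> (\<exists>n. \<omega> \<in> A (s n))" by (auto simp: B_def)
        then show "\<omega> \<in> (\<Union>n. A' n)"
        proof
          assume "\<omega> \<in> B"
          then have "\<omega> \<in> A' 0" by (simp add: A'_def)
          then show ?thesis by blast
        qed (use A'A(2) in blast)
      qed
    qed
    then have "(\<Union>n. D n) = space M" by (simp add: D_def UN_disjointed_eq)
    moreover have D: "range D \<subseteq> sets M"
      unfolding D_def by (rule sets.range_disjointed_sets) (use A' in auto)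
    moreover have "disjoint_family D" unfolding D_def by (rule disjoint_family_disjointed)
    ultimately obtain z where z: "z \<in> C"
      and zs: "\<And>n. L0_indicator M (D n) \<odot>\<^bsub>E\<^esub> z = L0_indicator M (D n) \<odot>\<^bsub>E\<^esub> s n"
      using conc s unfolding countable_concatenation_def by meson
    have zE: "z \<in> carrier E" using z C by blast
    have "D n \<in> sets M" for n using D by blast
    then have "AE \<omega> in M. \<forall>n. \<omega> \<in> D n \<longrightarrow>
        sum_seminorm Q (z \<ominus>\<^bsub>E\<^esub> x) \<omega> = sum_seminorm Q (s n \<ominus>\<^bsub>E\<^esub> x) \<omega>"
      unfolding AE_all_countable using sum_seminorm_indicator_cong[OF Q _ zE sE x zs] by blast
    with notB AE_space have small: "AE \<omega> in M. sum_seminorm Q (z \<ominus>\<^bsub>E\<^esub> x) \<omega> < \<epsilon> \<omega>"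
    proof eventually_elim
      case (elim \<omega>)
      then obtain n where n: "\<omega> \<in> D n" using \<open>(\<Union>n. D n) = space M\<close> by blast
      then have "\<omega> \<in> A' n" using disjointed_subset[of A' n] by (auto simp: D_def)
      then have "\<omega> \<in> A (s n)" using A'A(1) elim(1) by blast
      with n elim(3) show ?case by (simp add: A_def)
    qed
    have zx: "z \<ominus>\<^bsub>E\<^esub> x \<in> carrier E" using zE x by simp
    have "AE \<omega> in M. \<forall>p\<in>Q. 0 \<le> rv_rep (p (z \<ominus>\<^bsub>E\<^esub> x)) \<omega>"
      using seminorm_rep(3)[OF _ zx] Q by (intro AE_finite_allI) auto
    with small \<epsilon>e have "AE \<omega> in M. \<forall>p\<in>Q. rv_rep (p (z \<ominus>\<^bsub>E\<^esub> x)) \<omega> \<le> rv_rep e \<omega>"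
    proof eventually_elim
      case (elim \<omega>)
      have "rv_rep (p (z \<ominus>\<^bsub>E\<^esub> x)) \<omega> \<le> sum_seminorm Q (z \<ominus>\<^bsub>E\<^esub> x) \<omega>" if "p \<in> Q" for p
        unfolding sum_seminorm_def using elim(3) Q(1) that
        by (intro member_le_sum[where f = "\<lambda>p. rv_rep (p (z \<ominus>\<^bsub>E\<^esub> x)) \<omega>"]) auto
      with elim(1,2) show ?case by force
    qed
    then have "z \<ominus>\<^bsub>E\<^esub> x \<in> L0_nbhd M E Q e" using zx L0_nbhd_iff[OF Q e'(1)] by blast
    then have "x \<oplus>\<^bsub>E\<^esub> (z \<ominus>\<^bsub>E\<^esub> x) \<notin> C" using sub by blast
    moreover have "x \<oplus>\<^bsub>E\<^esub> (z \<ominus>\<^bsub>E\<^esub> x) = z"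
      using M.add.m_lcomm[of x z "\<ominus>\<^bsub>E\<^esub> x"] zE x by (simp add: a_minus_def M.r_neg)
    ultimately show False using z by simp
  qed
  then have "measure M B > 0" using measure_nonneg[of M B] by linarith
  moreover have "AE \<omega> in M. \<omega> \<in> B \<longrightarrow> \<epsilon> \<omega> \<le> sum_seminorm Q (y \<ominus>\<^bsub>E\<^esub> x) \<omega>" if "y \<in> C" for y
    using ub[OF that] AE_space
  proof eventually_elim
    case (elim \<omega>)
    show ?case
    proof
      assume "\<omega> \<in> B"
      with elim(1) have "\<omega> \<notin> A y" by (auto simp: B_def)
      with elim(2) show "\<epsilon> \<omega> \<le> sum_seminorm Q (y \<ominus>\<^bsub>E\<^esub> x) \<omega>" by (simp add: A_def not_less)
    qed
  qed
  ultimately show thesis using that[OF Q \<epsilon> \<epsilon>0 B] by blast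
qed

text \<open>Convexity in homogeneous form, with the weights normalized to t / (t + s) and its
  complement. It makes the multiples of y - x closed under addition.\<close>

lemma convex_combination:
  assumes conv: "L0_convex M K E C" and y: "y \<in> C" "y' \<in> C" "C \<subseteq> carrier E"
    and t: "0 \<le> t" "0 \<le> s" "0 < t + s"
  obtains v where "v \<in> C"
    "L0_of_real M (\<lambda>_. t + s) \<odot>\<^bsub>E\<^esub> v = L0_of_real M (\<lambda>_. t) \<odot>\<^bsub>E\<^esub> y \<oplus>\<^bsub>E\<^esub> L0_of_real M (\<lambda>_. s) \<odot>\<^bsub>E\<^esub> y'"
proof -
  let ?c = "t / (t + s)"
  have c: "0 \<le> ?c" "?c \<le> 1" using t by auto
  have yc: "y \<in> carrier E" "y' \<in> carrier E" using y by auto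
  have r: "AE \<omega> in M. rv_rep (rv_class M (\<lambda>_. ?c)) \<omega> = ?c" by (rule rv_rep_class(2)) simp
  have "AE \<omega> in M. 0 \<le> rv_rep (rv_class M (\<lambda>_. ?c)) \<omega>" using r by eventually_elim (use c in simp)
  then have "rv_class M (\<lambda>_. ?c) \<in> L0_plus M" by (simp add: L0_plus_iff)
  moreover have "rv_on M (space M) (\<le>) (rv_class M (\<lambda>_. ?c)) (rv_class M (\<lambda>_. 1))"
    using c by (simp add: rv_on_class)
  moreover have "rv_map M complex_of_real (rv_class M (\<lambda>_. ?c)) = L0_of_real M (\<lambda>_. ?c)"
    by (simp add: rv_map_class L0_of_real_def)
  moreover have "\<one>\<^bsub>L0_ring M K\<^esub> \<ominus>\<^bsub>L0_ring M K\<^esub> L0_of_real M (\<lambda>_. ?c) = L0_of_real M (\<lambda>_. 1 - ?c)"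
    by (simp add: a_minus_def L0_of_real_one L0_of_real_minus L0_of_real_ops)
  ultimately have "L0_of_real M (\<lambda>_. ?c) \<odot>\<^bsub>E\<^esub> y \<oplus>\<^bsub>E\<^esub> L0_of_real M (\<lambda>_. 1 - ?c) \<odot>\<^bsub>E\<^esub> y' \<in> C"
    using conv y unfolding L0_convex_def by metis
  moreover have "L0_of_real M (\<lambda>_. t + s) \<odot>\<^bsub>E\<^esub> (L0_of_real M (\<lambda>_. ?c) \<odot>\<^bsub>E\<^esub> y \<oplus>\<^bsub>E\<^esub> L0_of_real M (\<lambda>_. 1 - ?c) \<odot>\<^bsub>E\<^esub> y')
      = L0_of_real M (\<lambda>_. t) \<odot>\<^bsub>E\<^esub> y \<oplus>\<^bsub>E\<^esub> L0_of_real M (\<lambda>_. s) \<odot>\<^bsub>E\<^esub> y'"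
  proof -
    have "(t + s) * ?c = t" "(t + s) * (1 - ?c) = s" using t by (simp_all add: field_simps)
    then show ?thesis using yc by (simp add: smult_r_distr L0_of_real_smult)
  qed
  ultimately show thesis by (rule that)
qed

text \<open>The pairs (t (y - x), t) with t >= 0 meet the requirements of
  \<open>additive_separation\<close>: sums stay inside by convexity, halving changes only t, and
  homogeneity scales the distance bound by t. The separating inequality is the constraint with t =
  1.\<close>

lemma real_separation:
  assumes x: "x \<in> carrier E" and C: "C \<subseteq> carrier E" "C \<noteq> {}" and conv: "L0_convex M K E C"
    and Q: "finite Q" "Q \<subseteq> P" and u: "u \<in> borel_measurable M"
    and far: "\<And>y. y \<in> C \<Longrightarrow> AE \<omega> in M. u \<omega> \<le> sum_seminorm Q (y \<ominus>\<^bsub>E\<^esub> x) \<omega>"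
  obtains f where "\<And>z. z \<in> carrier E \<Longrightarrow> f z \<in> borel_measurable M"
    and "\<And>z w. z \<in> carrier E \<Longrightarrow> w \<in> carrier E \<Longrightarrow>
      AE \<omega> in M. f (z \<oplus>\<^bsub>E\<^esub> w) \<omega> = f z \<omega> + f w \<omega>"
    and "\<And>z. z \<in> carrier E \<Longrightarrow> AE \<omega> in M. \<bar>f z \<omega>\<bar> \<le> sum_seminorm Q z \<omega>"
    and "\<And>g z. g \<in> borel_measurable M \<Longrightarrow> z \<in> carrier E \<Longrightarrow>
      AE \<omega> in M. f (L0_of_real M g \<odot>\<^bsub>E\<^esub> z) \<omega> = g \<omega> * f z \<omega>"
    and "\<And>y. y \<in> C \<Longrightarrow> AE \<omega> in M. u \<omega> \<le> f y \<omega> - f x \<omega>"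
proof -
  define N where "N = {(L0_of_real M (\<lambda>_. t) \<odot>\<^bsub>E\<^esub> (y \<ominus>\<^bsub>E\<^esub> x), t) | t y. y \<in> C \<and> 0 \<le> t}"
  have NI: "(L0_of_real M (\<lambda>_. t) \<odot>\<^bsub>E\<^esub> (y \<ominus>\<^bsub>E\<^esub> x), t) \<in> N" if "y \<in> C" "0 \<le> t" for t y
    using that by (auto simp: N_def)
  have cone: "L0_of_real M (\<lambda>_. t) \<odot>\<^bsub>E\<^esub> (y \<ominus>\<^bsub>E\<^esub> x) =
      L0_of_real M (\<lambda>_. t) \<odot>\<^bsub>E\<^esub> y \<oplus>\<^bsub>E\<^esub> L0_of_real M (\<lambda>_. - t) \<odot>\<^bsub>E\<^esub> x" if "y \<in> carrier E" for t y
    using that x L0_of_real_smult(1)[of "\<lambda>_. t" "\<lambda>_. - 1" x]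
    by (simp add: a_minus_def smult_r_distr L0_of_real_smult_minus)
  obtain y0 where y0: "y0 \<in> C" using C(2) by blast
  have zero_smult: "L0_of_real M (\<lambda>_. 0) \<odot>\<^bsub>E\<^esub> z = \<zero>\<^bsub>E\<^esub>" if "z \<in> carrier E" for z
    using smult_l_null[OF that] by (simp add: L0_of_real_zero)
  obtain f where f: "\<And>z. z \<in> carrier E \<Longrightarrow> f z \<in> borel_measurable M"
    and add: "\<And>z w. z \<in> carrier E \<Longrightarrow> w \<in> carrier E \<Longrightarrow>
      AE \<omega> in M. f (z \<oplus>\<^bsub>E\<^esub> w) \<omega> = f z \<omega> + f w \<omega>"
    and dom: "\<And>z. z \<in> carrier E \<Longrightarrow> AE \<omega> in M. f z \<omega> \<le> sum_seminorm Q z \<omega>"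
    and fN: "\<And>w t. (w, t) \<in> N \<Longrightarrow> AE \<omega> in M. t * u \<omega> \<le> f w \<omega>"
  proof (rule additive_separation[OF M.abelian_group_axioms dyadic_sublinear_sum_seminorm[OF Q] u, of N])
    show "N \<subseteq> carrier E \<times> UNIV" using x C by (auto simp: N_def)
    have "y0 \<ominus>\<^bsub>E\<^esub> x \<in> carrier E" using y0 x C by auto
    from zero_smult[OF this] show "(\<zero>\<^bsub>E\<^esub>, 0) \<in> N" using NI[OF y0, of 0] by simp
  next
    fix w t v s assume wv: "(w, t) \<in> N" "(v, s) \<in> N"
    then obtain y y' where y: "y \<in> C" "0 \<le> t" "w = L0_of_real M (\<lambda>_. t) \<odot>\<^bsub>E\<^esub> (y \<ominus>\<^bsub>E\<^esub> x)"
      and y': "y' \<in> C" "0 \<le> s" "v = L0_of_real M (\<lambda>_. s) \<odot>\<^bsub>E\<^esub> (y' \<ominus>\<^bsub>E\<^esub> x)"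
      by (auto simp: N_def)
    have yc: "y \<in> carrier E" "y' \<in> carrier E" using y y' C by auto
    show "(w \<oplus>\<^bsub>E\<^esub> v, t + s) \<in> N"
    \<comment> \<open>The weights cannot be normalized when both vanish; both vectors are then
      zero.\<close>
    proof (cases "t + s = 0")
      case True
      then have "t = 0" "s = 0" using y(2) y'(2) by auto
      then have "w = \<zero>\<^bsub>E\<^esub>" "v = \<zero>\<^bsub>E\<^esub>" using y(3) y'(3) zero_smult yc x by auto
      then show ?thesis using wv \<open>t = 0\<close> \<open>s = 0\<close> by simp
    next
      case False
      then have ts: "0 < t + s" using y(2) y'(2) by auto
      obtain b where b: "b \<in> C"
        "L0_of_real M (\<lambda>_. t + s) \<odot>\<^bsub>E\<^esub> b = L0_of_real M (\<lambda>_. t) \<odot>\<^bsub>E\<^esub> y \<oplus>\<^bsub>E\<^esub> L0_of_real M (\<lambda>_. s) \<odot>\<^bsub>E\<^esub> y'"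
        by (rule convex_combination[OF conv y(1) y'(1) C(1) y(2) y'(2) ts])
      have bc: "b \<in> carrier E" using b C by auto
      have xx: "L0_of_real M (\<lambda>_. - (t + s)) \<odot>\<^bsub>E\<^esub> x =
          L0_of_real M (\<lambda>_. - t) \<odot>\<^bsub>E\<^esub> x \<oplus>\<^bsub>E\<^esub> L0_of_real M (\<lambda>_. - s) \<odot>\<^bsub>E\<^esub> x"
        using x by (simp add: L0_of_real_smult)
      have "L0_of_real M (\<lambda>_. t + s) \<odot>\<^bsub>E\<^esub> (b \<ominus>\<^bsub>E\<^esub> x) = w \<oplus>\<^bsub>E\<^esub> v"
        unfolding y(3) y'(3) cone[OF yc(1)] cone[OF yc(2)] cone[OF bc] b(2) xx
        using yc x by (simp add: M.add.m_ac)
      with NI[OF b(1), of "t + s"] ts show ?thesis by simp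
    qed
  next
    fix w t assume "(w, t) \<in> N"
    then obtain y where y: "y \<in> C" "0 \<le> t" "w = L0_of_real M (\<lambda>_. t) \<odot>\<^bsub>E\<^esub> (y \<ominus>\<^bsub>E\<^esub> x)"
      by (auto simp: N_def)
    have yx: "y \<ominus>\<^bsub>E\<^esub> x \<in> carrier E" using y x C by auto
    show "\<exists>v. (v, t / 2) \<in> N \<and> v \<oplus>\<^bsub>E\<^esub> v = w"
      using NI[OF y(1), of "t / 2"] y(2) L0_of_real_smult(2)[of "\<lambda>_. t / 2" "\<lambda>_. t / 2", OF _ _ yx] y(3)
      by auto
    show "AE \<omega> in M. t * u \<omega> \<le> sum_seminorm Q w \<omega>"
      using far[OF y(1)] sum_seminorm_L0_of_real[OF Q yx, of "\<lambda>_. t", simplified]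
      unfolding y(3) by eventually_elim (use y(2) in \<open>simp add: mult_left_mono\<close>)
  qed blast
  have abs: "AE \<omega> in M. \<bar>f z \<omega>\<bar> \<le> sum_seminorm Q z \<omega>" if "z \<in> carrier E" for z
    by (rule additive_dominated_abs[OF _ _ _ _ that]; rule f add dom sum_seminorm_L0_of_real[OF Q]; assumption)
  have L0_of_real: "AE \<omega> in M. f (L0_of_real M g \<odot>\<^bsub>E\<^esub> z) \<omega> = g \<omega> * f z \<omega>"
    if "g \<in> borel_measurable M" "z \<in> carrier E" for g z
    by (rule additive_dominated_L0_of_real[OF _ _ _ _ that(2,1)]; rule f add dom sum_seminorm_L0_of_real[OF Q]; assumption)
  show thesis
  proof
    fix y assume y: "y \<in> C"
    then have yc: "y \<in> carrier E" using C by blast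
    have "AE \<omega> in M. f (y \<ominus>\<^bsub>E\<^esub> x) \<omega> = f y \<omega> + f (L0_of_real M (\<lambda>_. - 1) \<odot>\<^bsub>E\<^esub> x) \<omega>"
      using add[OF yc M.a_inv_closed[OF x]] x by (simp add: a_minus_def L0_of_real_smult_minus)
    moreover have "AE \<omega> in M. f (L0_of_real M (\<lambda>_. - 1) \<odot>\<^bsub>E\<^esub> x) \<omega> = - 1 * f x \<omega>"
      using x by (intro L0_of_real) auto
    moreover have "AE \<omega> in M. 1 * u \<omega> \<le> f (y \<ominus>\<^bsub>E\<^esub> x) \<omega>"
      using fN[OF NI[OF y, of 1]] yc x by (simp add: L0_of_real_smult_one)
    ultimately show "AE \<omega> in M. u \<omega> \<le> f y \<omega> - f x \<omega>" by eventually_elim simp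
  qed (rule f add abs L0_of_real; assumption)+
qed

section \<open>Extension to the scalar field and conclusion\<close>

text \<open>For complex scalars this is the Bohnenblust-Sobczyk formula h z = f z - i f (i z), with
  i the constant class in L0. Bounding the modulus by the sum of the absolute real and imaginary
  parts gives the factor 2, which is good enough for continuity.\<close>

lemma scalar_extension:
  assumes f: "\<And>z. z \<in> carrier E \<Longrightarrow> f z \<in> borel_measurable M"
    and add: "\<And>z w. z \<in> carrier E \<Longrightarrow> w \<in> carrier E \<Longrightarrow>
      AE \<omega> in M. f (z \<oplus>\<^bsub>E\<^esub> w) \<omega> = f z \<omega> + f w \<omega>"
    and dom: "\<And>z. z \<in> carrier E \<Longrightarrow> AE \<omega> in M. \<bar>f z \<omega>\<bar> \<le> sum_seminorm Q z \<omega>"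
    and smult: "\<And>g z. g \<in> borel_measurable M \<Longrightarrow> z \<in> carrier E \<Longrightarrow>
      AE \<omega> in M. f (L0_of_real M g \<odot>\<^bsub>E\<^esub> z) \<omega> = g \<omega> * f z \<omega>"
    and Q: "finite Q" "Q \<subseteq> P"
  obtains h where "\<And>z. z \<in> carrier E \<Longrightarrow> h z \<in> borel_measurable M"
    and "\<And>z \<omega>. h z \<omega> \<in> K"
    and "\<And>z w. z \<in> carrier E \<Longrightarrow> w \<in> carrier E \<Longrightarrow>
      AE \<omega> in M. h (z \<oplus>\<^bsub>E\<^esub> w) \<omega> = h z \<omega> + h w \<omega>"
    and "\<And>g z. g \<in> borel_measurable M \<Longrightarrow> (\<And>\<omega>. \<omega> \<in> space M \<Longrightarrow> g \<omega> \<in> K) \<Longrightarrow> z \<in> carrier E \<Longrightarrow>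
      AE \<omega> in M. h (rv_class M g \<odot>\<^bsub>E\<^esub> z) \<omega> = g \<omega> * h z \<omega>"
    and "\<And>z \<omega>. Re (h z \<omega>) = f z \<omega>"
    and "\<And>z. z \<in> carrier E \<Longrightarrow> AE \<omega> in M. cmod (h z \<omega>) \<le> 2 * sum_seminorm Q z \<omega>"
proof (cases "K = \<real>")
  case True
  show thesis
  proof
    fix z and g :: "'a \<Rightarrow> complex" assume z: "z \<in> carrier E" and g: "g \<in> borel_measurable M" "\<And>\<omega>. \<omega> \<in> space M \<Longrightarrow> g \<omega> \<in> K"
    \<comment> \<open>For real \<open>K\<close> the scalars are still complex-valued functions;
      taking real parts recovers them on the whole space.\<close>
    have Re: "complex_of_real (Re (g \<omega>)) = g \<omega>" if "\<omega> \<in> space M" for \<omega>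
      using g(2)[OF that] True by (simp add: of_real_Re)
    have "rv_class M g = L0_of_real M (\<lambda>\<omega>. Re (g \<omega>))"
      unfolding L0_of_real_def by (rule rv_class_cong) (auto simp: Re)
    moreover have "AE \<omega> in M. f (L0_of_real M (\<lambda>\<omega>. Re (g \<omega>)) \<odot>\<^bsub>E\<^esub> z) \<omega> = Re (g \<omega>) * f z \<omega>"
      using g z by (intro smult) auto
    ultimately have "AE \<omega> in M. f (rv_class M g \<odot>\<^bsub>E\<^esub> z) \<omega> = Re (g \<omega>) * f z \<omega>" by simp
    then show "AE \<omega> in M. complex_of_real (f (rv_class M g \<odot>\<^bsub>E\<^esub> z) \<omega>) = g \<omega> * complex_of_real (f z \<omega>)"
      using AE_space by eventually_elim (simp add: Re)
  next
    fix z assume z: "z \<in> carrier E"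
    show "AE \<omega> in M. cmod (complex_of_real (f z \<omega>)) \<le> 2 * sum_seminorm Q z \<omega>"
      using dom[OF z] by eventually_elim simp
  next
    fix z w assume "z \<in> carrier E" "w \<in> carrier E"
    from add[OF this] show "AE \<omega> in M. complex_of_real (f (z \<oplus>\<^bsub>E\<^esub> w) \<omega>) =
        complex_of_real (f z \<omega>) + complex_of_real (f w \<omega>)"
      by eventually_elim simp
  qed (use f True in auto)
next
  case False
  then have K: "K = UNIV" using K_cases by blast
  define i where "i = rv_class M (\<lambda>_. \<i>)"
  have i: "i \<in> carrier (L0_ring M K)" unfolding i_def by (rule rv_class_carrier) (auto simp: K)
  define h where "h z \<omega> = Complex (f z \<omega>) (- f (i \<odot>\<^bsub>E\<^esub> z) \<omega>)" for z \<omega>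
  have h_eq: "h z = (\<lambda>\<omega>. complex_of_real (f z \<omega>) - \<i> * complex_of_real (f (i \<odot>\<^bsub>E\<^esub> z) \<omega>))" for z
    by (auto simp: h_def complex_eq_iff)
  show thesis
  proof
    fix z assume z: "z \<in> carrier E"
    note iz = smult_closed[OF i z]
    show "h z \<in> borel_measurable M" unfolding h_eq using f[OF z] f[OF iz] by measurable
    have "AE \<omega> in M. sum_seminorm Q (i \<odot>\<^bsub>E\<^esub> z) \<omega> = cmod \<i> * sum_seminorm Q z \<omega>"
      unfolding i_def by (rule sum_seminorm_smult[OF Q z]) (auto simp: K)
    with dom[OF z] dom[OF iz]
    show "AE \<omega> in M. cmod (h z \<omega>) \<le> 2 * sum_seminorm Q z \<omega>"
    proof eventually_elim
      case (elim \<omega>)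
      then show ?case using cmod_le[of "h z \<omega>"] by (simp add: h_def)
    qed
  next
    fix z w assume zw: "z \<in> carrier E" "w \<in> carrier E"
    have "AE \<omega> in M. f (i \<odot>\<^bsub>E\<^esub> (z \<oplus>\<^bsub>E\<^esub> w)) \<omega> = f (i \<odot>\<^bsub>E\<^esub> z) \<omega> + f (i \<odot>\<^bsub>E\<^esub> w) \<omega>"
      using add[OF smult_closed[OF i zw(1)] smult_closed[OF i zw(2)]] smult_r_distr[OF i zw] by simp
    with add[OF zw] show "AE \<omega> in M. h (z \<oplus>\<^bsub>E\<^esub> w) \<omega> = h z \<omega> + h w \<omega>"
      by eventually_elim (simp add: h_def complex_eq_iff)
  next
    fix g :: "'a \<Rightarrow> complex" and z assume g: "g \<in> borel_measurable M" and z: "z \<in> carrier E"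
    define a b where "a \<omega> = Re (g \<omega>)" and "b \<omega> = Im (g \<omega>)" for \<omega>
    have a: "a \<in> borel_measurable M" and b: "b \<in> borel_measurable M"
      unfolding a_def b_def using g by measurable
    note iz = smult_closed[OF i z]
    have gc: "rv_class M g \<in> carrier (L0_ring M K)" using g by (intro rv_class_carrier) (auto simp: K)
    \<comment> \<open>With g = a + b i and i g = a i - b, both parts of h (g z) reduce to real
      multiples of \<open>z\<close> and of i z, for which homogeneity is known.\<close>
    have g1: "rv_class M g = L0_of_real M a \<oplus>\<^bsub>L0_ring M K\<^esub> L0_of_real M b \<otimes>\<^bsub>L0_ring M K\<^esub> i"
    proof -
      have "g = (\<lambda>\<omega>. complex_of_real (a \<omega>) + complex_of_real (b \<omega>) * \<i>)"
        by (auto simp: a_def b_def complex_eq_iff)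
      then show ?thesis unfolding L0_of_real_def i_def using a b by (simp add: L0_ring_ops)
    qed
    have g2: "i \<otimes>\<^bsub>L0_ring M K\<^esub> rv_class M g = L0_of_real M a \<otimes>\<^bsub>L0_ring M K\<^esub> i \<oplus>\<^bsub>L0_ring M K\<^esub> L0_of_real M (\<lambda>\<omega>. - b \<omega>)"
    proof -
      have "(\<lambda>\<omega>. \<i> * g \<omega>) = (\<lambda>\<omega>. complex_of_real (a \<omega>) * \<i> + complex_of_real (- b \<omega>))"
        by (auto simp: a_def b_def complex_eq_iff)
      then show ?thesis unfolding L0_of_real_def i_def using a b g by (simp add: L0_ring_ops)
    qed
    have gz: "rv_class M g \<odot>\<^bsub>E\<^esub> z = L0_of_real M a \<odot>\<^bsub>E\<^esub> z \<oplus>\<^bsub>E\<^esub> L0_of_real M b \<odot>\<^bsub>E\<^esub> (i \<odot>\<^bsub>E\<^esub> z)"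
      unfolding g1 using a b i z by (simp add: smult_l_distr smult_assoc1)
    have "i \<odot>\<^bsub>E\<^esub> (rv_class M g \<odot>\<^bsub>E\<^esub> z) = (i \<otimes>\<^bsub>L0_ring M K\<^esub> rv_class M g) \<odot>\<^bsub>E\<^esub> z"
      using i gc z by (simp add: smult_assoc1)
    also have "\<dots> = L0_of_real M a \<odot>\<^bsub>E\<^esub> (i \<odot>\<^bsub>E\<^esub> z) \<oplus>\<^bsub>E\<^esub> L0_of_real M (\<lambda>\<omega>. - b \<omega>) \<odot>\<^bsub>E\<^esub> z"
      unfolding g2 using a b i z by (simp add: smult_l_distr smult_assoc1)
    finally have igz: "i \<odot>\<^bsub>E\<^esub> (rv_class M g \<odot>\<^bsub>E\<^esub> z) =
        L0_of_real M a \<odot>\<^bsub>E\<^esub> (i \<odot>\<^bsub>E\<^esub> z) \<oplus>\<^bsub>E\<^esub> L0_of_real M (\<lambda>\<omega>. - b \<omega>) \<odot>\<^bsub>E\<^esub> z" .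
    have nb: "(\<lambda>\<omega>. - b \<omega>) \<in> borel_measurable M" using b by simp
    have "AE \<omega> in M. f (rv_class M g \<odot>\<^bsub>E\<^esub> z) \<omega> =
        f (L0_of_real M a \<odot>\<^bsub>E\<^esub> z) \<omega> + f (L0_of_real M b \<odot>\<^bsub>E\<^esub> (i \<odot>\<^bsub>E\<^esub> z)) \<omega>"
      unfolding gz using a b i z by (intro add) auto
    moreover have "AE \<omega> in M. f (i \<odot>\<^bsub>E\<^esub> (rv_class M g \<odot>\<^bsub>E\<^esub> z)) \<omega> =
        f (L0_of_real M a \<odot>\<^bsub>E\<^esub> (i \<odot>\<^bsub>E\<^esub> z)) \<omega> + f (L0_of_real M (\<lambda>\<omega>. - b \<omega>) \<odot>\<^bsub>E\<^esub> z) \<omega>"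
      unfolding igz using a nb i z by (intro add) auto
    ultimately show "AE \<omega> in M. h (rv_class M g \<odot>\<^bsub>E\<^esub> z) \<omega> = g \<omega> * h z \<omega>"
      using smult[OF a z] smult[OF b iz] smult[OF a iz] smult[OF nb z]
      by eventually_elim (simp add: h_def complex_eq_iff a_def b_def)
  qed (auto simp: h_def K)
qed

lemma strict_separation:
  assumes x: "x \<in> carrier E" and C: "C \<subseteq> carrier E" "C \<noteq> {}"
    and closed: "closedin (Tc M E P) C" and conv: "L0_convex M K E C"
    and conc: "countable_concatenation M E C" and "x \<notin> C"
  shows "\<exists>F \<in> Ec_dual M K E P. \<exists>B \<in> sets M. measure M B > 0 \<and>
    rv_on M B (>) (rv_map M (\<lambda>z. ereal (Re z)) (F x))
      (\<Squnion>\<^bsub>L0_bar M\<^esub>((\<lambda>y. rv_map M (\<lambda>z. ereal (Re z)) (F y)) ` C)) \<and>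
    rv_on M (space M - B) (=) (rv_map M (\<lambda>z. ereal (Re z)) (F x))
      (\<Squnion>\<^bsub>L0_bar M\<^esub>((\<lambda>y. rv_map M (\<lambda>z. ereal (Re z)) (F y)) ` C))"
proof -
  obtain Q \<epsilon> B where Q: "finite Q" "Q \<subseteq> P" and \<epsilon>: "\<epsilon> \<in> borel_measurable M" "\<And>\<omega>. 0 < \<epsilon> \<omega>"
    and B: "B \<in> sets M" "measure M B > 0"
    and far: "\<And>y. y \<in> C \<Longrightarrow> AE \<omega> in M. \<omega> \<in> B \<longrightarrow> \<epsilon> \<omega> \<le> sum_seminorm Q (y \<ominus>\<^bsub>E\<^esub> x) \<omega>"
    using distance_positive_on[OF x C closed conc \<open>x \<notin> C\<close>] by blast
  \<comment> \<open>Off \<open>B\<close> the value 0 is dominated by the nonnegative seminorm, so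
    the distance bound holds on the whole space.\<close>
  define u where "u \<omega> = indicator B \<omega> * \<epsilon> \<omega>" for \<omega>
  have u: "u \<in> borel_measurable M" unfolding u_def using B(1) \<epsilon>(1) by measurable
  have far_u: "AE \<omega> in M. u \<omega> \<le> sum_seminorm Q (y \<ominus>\<^bsub>E\<^esub> x) \<omega>" if y: "y \<in> C" for y
  proof -
    have "y \<ominus>\<^bsub>E\<^esub> x \<in> carrier E" using y C x by auto
    from far[OF y] sum_seminorm_nonneg[OF Q this] show ?thesis
      by eventually_elim (auto simp: u_def indicator_def)
  qed
  obtain f where f: "\<And>z. z \<in> carrier E \<Longrightarrow> f z \<in> borel_measurable M"
    and f_add: "\<And>z w. z \<in> carrier E \<Longrightarrow> w \<in> carrier E \<Longrightarrow>
      AE \<omega> in M. f (z \<oplus>\<^bsub>E\<^esub> w) \<omega> = f z \<omega> + f w \<omega>"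
    and f_dom: "\<And>z. z \<in> carrier E \<Longrightarrow> AE \<omega> in M. \<bar>f z \<omega>\<bar> \<le> sum_seminorm Q z \<omega>"
    and f_smult: "\<And>g z. g \<in> borel_measurable M \<Longrightarrow> z \<in> carrier E \<Longrightarrow>
      AE \<omega> in M. f (L0_of_real M g \<odot>\<^bsub>E\<^esub> z) \<omega> = g \<omega> * f z \<omega>"
    and f_sep: "\<And>y. y \<in> C \<Longrightarrow> AE \<omega> in M. u \<omega> \<le> f y \<omega> - f x \<omega>"
    using real_separation[OF x C conv Q u far_u] by blast
  obtain h where h: "\<And>z. z \<in> carrier E \<Longrightarrow> h z \<in> borel_measurable M"
    and hK: "\<And>z \<omega>. h z \<omega> \<in> K"
    and h_add: "\<And>z w. z \<in> carrier E \<Longrightarrow> w \<in> carrier E \<Longrightarrow>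
      AE \<omega> in M. h (z \<oplus>\<^bsub>E\<^esub> w) \<omega> = h z \<omega> + h w \<omega>"
    and h_smult: "\<And>g z. g \<in> borel_measurable M \<Longrightarrow> (\<And>\<omega>. \<omega> \<in> space M \<Longrightarrow> g \<omega> \<in> K) \<Longrightarrow>
      z \<in> carrier E \<Longrightarrow> AE \<omega> in M. h (rv_class M g \<odot>\<^bsub>E\<^esub> z) \<omega> = g \<omega> * h z \<omega>"
    and h_Re: "\<And>z \<omega>. Re (h z \<omega>) = f z \<omega>"
    and h_dom: "\<And>z. z \<in> carrier E \<Longrightarrow> AE \<omega> in M. cmod (h z \<omega>) \<le> 2 * sum_seminorm Q z \<omega>"
    using scalar_extension[OF f f_add f_dom f_smult Q] by blast
  \<comment> \<open>The minus sign puts \<open>x\<close> above \<open>C\<close>; the indicator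
    annihilates the functional off \<open>B\<close>, as the required equality there demands.\<close>
  define k where "k z \<omega> = - (indicator B \<omega> * h z \<omega>)" for z \<omega>
  define F where "F z = rv_class M (k z)" for z
  have k: "k z \<in> borel_measurable M" if "z \<in> carrier E" for z
    unfolding k_def using h[OF that] B(1) by measurable
  have kK: "k z \<omega> \<in> K" for z \<omega>
    using hK[of z \<omega>] K_cases by (auto simp: k_def indicator_def)
  have Fc: "F z \<in> carrier (L0_ring M K)" if "z \<in> carrier E" for z
    unfolding F_def using k[OF that] kK by (intro rv_class_carrier)
  have F_add: "F (z \<oplus>\<^bsub>E\<^esub> w) = F z \<oplus>\<^bsub>L0_ring M K\<^esub> F w" if zw: "z \<in> carrier E" "w \<in> carrier E" for z w
  proof -
    have "AE \<omega> in M. k (z \<oplus>\<^bsub>E\<^esub> w) \<omega> = k z \<omega> + k w \<omega>"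
      using h_add[OF zw] by eventually_elim (simp add: k_def algebra_simps)
    from rv_class_cong[OF this] show ?thesis using k zw by (simp add: F_def L0_ring_ops)
  qed
  have F_smult: "F (\<xi> \<odot>\<^bsub>E\<^esub> z) = \<xi> \<otimes>\<^bsub>L0_ring M K\<^esub> F z"
    if \<xi>: "\<xi> \<in> carrier (L0_ring M K)" and z: "z \<in> carrier E" for \<xi> z
  proof -
    obtain g where g: "g \<in> borel_measurable M" "\<And>\<omega>. \<omega> \<in> space M \<Longrightarrow> g \<omega> \<in> K" "\<xi> = rv_class M g"
      using carrier_L0_ringE[OF \<xi>] by blast
    have "AE \<omega> in M. k (\<xi> \<odot>\<^bsub>E\<^esub> z) \<omega> = g \<omega> * k z \<omega>"
    proof -
      have "AE \<omega> in M. h (rv_class M g \<odot>\<^bsub>E\<^esub> z) \<omega> = g \<omega> * h z \<omega>"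
        by (rule h_smult) (use g z in auto)
      then show ?thesis unfolding g(3) by eventually_elim (simp add: k_def)
    qed
    from rv_class_cong[OF this] show ?thesis using k[OF z] g by (simp add: F_def L0_ring_ops)
  qed
  have "AE \<omega> in M. cmod (rv_rep (F z) \<omega>) \<le> 2 * sum_seminorm Q z \<omega>" if z: "z \<in> carrier E" for z
    using rv_rep_class(2)[OF k[OF z]] h_dom[OF z] sum_seminorm_nonneg[OF Q z]
    by eventually_elim (auto simp: F_def k_def norm_mult indicator_def)
  then have "continuous_map (Tc M E P) (Tc M (L0_ring M K) {rv_map M cmod}) F"
    using Fc F_add by (intro dominated_functional_continuous[OF Q, where c = 2]) auto
  then have F: "F \<in> Ec_dual M K E P" unfolding Ec_dual_def using Fc F_add F_smult by auto

  let ?re = "rv_map M (\<lambda>z. ereal (Re z))"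
  define r where "r z \<omega> = ereal (- (indicator B \<omega> * f z \<omega>))" for z \<omega>
  have r: "r z \<in> borel_measurable M" if "z \<in> carrier E" for z
    unfolding r_def using f[OF that] B(1) by measurable
  have re: "?re (F z) = rv_class M (r z)" if "z \<in> carrier E" for z
  proof -
    have "(\<lambda>\<omega>. ereal (Re (k z \<omega>))) = r z"
      by (auto simp: k_def r_def h_Re indicator_def)
    then show ?thesis unfolding F_def rv_map_class[OF k[OF that]] by simp
  qed
  let ?S = "(\<lambda>y. ?re (F y)) ` C"
  let ?s = "\<Squnion>\<^bsub>L0_bar M\<^esub>?S"
  have SL: "?S \<subseteq> L0 M" using re r C by auto
  have least: "least (L0_bar M) ?s (Upper (L0_bar M) ?S)"
    by (rule L0_bar_Sup_least) (use SL C in auto)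
  then have sL: "?s \<in> L0 M" by (auto simp: least_def Upper_def)
  \<comment> \<open>On \<open>B\<close> this upper bound of all values on \<open>C\<close> lies
    below the value at \<open>x\<close> by \<open>\<epsilon> \<omega>\<close>. The gap does not
    depend on y, so strictness survives the supremum.\<close>
  define b where "b \<omega> = ereal (- (indicator B \<omega> * (f x \<omega> + \<epsilon> \<omega>)))" for \<omega>
  have b: "b \<in> borel_measurable M" unfolding b_def using f[OF x] \<epsilon>(1) B(1) by measurable
  have "rv_class M b \<in> Upper (L0_bar M) ?S"
  proof -
    have "?re (F y) \<sqsubseteq>\<^bsub>L0_bar M\<^esub> rv_class M b" if y: "y \<in> C" for y
    proof -
      have yc: "y \<in> carrier E" using y C by blast
      have "AE \<omega> in M. rv_rep (rv_class M (r y)) \<omega> \<le> rv_rep (rv_class M b) \<omega>"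
        using rv_rep_class(2)[OF r[OF yc]] rv_rep_class(2)[OF b] f_sep[OF y]
        by eventually_elim (auto simp: r_def b_def u_def indicator_def)
      then show ?thesis unfolding re[OF yc] using r[OF yc] b by (simp add: L0_bar_le_iff)
    qed
    then show ?thesis using b by (auto simp: Upper_def)
  qed
  with least have "?s \<sqsubseteq>\<^bsub>L0_bar M\<^esub> rv_class M b" by (auto simp: least_def)
  then have s_le: "AE \<omega> in M. rv_rep ?s \<omega> \<le> rv_rep (rv_class M b) \<omega>"
    using sL b by (simp add: L0_bar_le_iff)
  \<comment> \<open>One member of \<open>C\<close> bounds the supremum from below; off
    \<open>B\<close> this pins it to zero.\<close>
  obtain y0 where y0: "y0 \<in> C" using C(2) by blast
  then have y0c: "y0 \<in> carrier E" using C by blast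
  have "?re (F y0) \<sqsubseteq>\<^bsub>L0_bar M\<^esub> ?s"
    using least y0 SL by (auto simp: least_def Upper_def)
  then have s_ge: "AE \<omega> in M. rv_rep (rv_class M (r y0)) \<omega> \<le> rv_rep ?s \<omega>"
    using sL r[OF y0c] by (simp add: re[OF y0c] L0_bar_le_iff)
  have main: "AE \<omega> in M. (\<omega> \<in> B \<longrightarrow> rv_rep (?re (F x)) \<omega> > rv_rep ?s \<omega>) \<and>
      (\<omega> \<notin> B \<longrightarrow> rv_rep (?re (F x)) \<omega> = rv_rep ?s \<omega>)"
    unfolding re[OF x]
    using s_le s_ge rv_rep_class(2)[OF b] rv_rep_class(2)[OF r[OF x]] rv_rep_class(2)[OF r[OF y0c]]
  proof eventually_elim
    case (elim \<omega>)
    show ?case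
    proof (cases "\<omega> \<in> B")
      case True
      then have "b \<omega> < r x \<omega>" using \<epsilon>(2)[of \<omega>] by (simp add: b_def r_def)
      with True elim show ?thesis by auto
    next
      case False
      then have "b \<omega> = 0" "r x \<omega> = 0" "r y0 \<omega> = 0" by (auto simp: b_def r_def zero_ereal_def)
      with False elim show ?thesis by auto
    qed
  qed
  show ?thesis
  proof (intro bexI[OF _ F] bexI[OF _ B(1)] conjI)
    show "rv_on M B (>) (?re (F x)) ?s"
      unfolding rv_on_def using main by eventually_elim blast
    show "rv_on M (space M - B) (=) (?re (F x)) ?s"
      unfolding rv_on_def using main by eventually_elim blast
  qed (rule B(2))
qed

end

theorem corollary3p9:
  fixes M :: "'a measure" and K :: "complex set"
    and E :: "(('a \<Rightarrow> complex) set, 'e, 'm) module_scheme"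
    and P :: "('e \<Rightarrow> ('a \<Rightarrow> real) set) set"
    and x :: 'e and C :: "'e set"
  assumes "random_locally_convex_module M K E P"
    and "x \<in> carrier E"
    and "C \<subseteq> carrier E" and "C \<noteq> {}"
    and "closedin (Tc M E P) C"
    and "L0_convex M K E C"
    and "countable_concatenation M E C"
    and "x \<notin> C"
  shows "\<exists>f \<in> Ec_dual M K E P. \<exists>B \<in> sets M. measure M B > 0 \<and>
    rv_on M B (>) (rv_map M (\<lambda>z. ereal (Re z)) (f x))
      (\<Squnion>\<^bsub>L0_bar M\<^esub>((\<lambda>y. rv_map M (\<lambda>z. ereal (Re z)) (f y)) ` C)) \<and>
    rv_on M (space M - B) (=) (rv_map M (\<lambda>z. ereal (Re z)) (f x))
      (\<Squnion>\<^bsub>L0_bar M\<^esub>((\<lambda>y. rv_map M (\<lambda>z. ereal (Re z)) (f y)) ` C))"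
  using random_locally_convex_module.strict_separation[OF assms] .

end
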